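(* Let $\gamma>0$ and let $\mu$ be a distribution on $\mathbb{R}$ with $\widehat\mu(\gamma)<\infty$ and $\widehat\mu(\gamma+iz)\neq0$ for every $z\in\mathbb{R}$. If $\mu^{n*}\in\mathcal{S}(\gamma)$ for some $n\in\mathbb{N}$, then $\mu\in\mathcal{S}(\gamma)$.
   Context: For a probability distribution $\rho$ on $\mathbb{R}$: $\bar\rho(x):=\rho((x,\infty))$, $\rho^{n*}$ is the $n$-th convolution power, $\widehat\rho(\gamma):=\int e^{\gamma x}\rho(dx)$, and when $\widehat\rho(\gamma)<\infty$, $\widehat\rho(\gamma+iz):=\int e^{(\gamma+iz)x}\rho(dx)$ for $z\in\mathbb{R}$. $f\sim g$ means $f(x)/g(x)\to1$ as $x\to\infty$. For $\gamma\ge0$: $\rho\in\mathcal{L}(\gamma)$ if $\bar\rho(x)>0$ for all $x$ and $\bar\rho(x+a)\sim e^{-\gamma a}\bar\rho(x)$ for every $a\in\mathbb{R}$; $\rho\in\mathcal{S}(\gamma)$ if $\rho\in\mathcal{L}(\gamma)$, $\widehat\rho(\gamma)<\infty$ and $\overline{\rho^{2*}}(x)\sim2\widehat\rho(\gamma)\bar\rho(x)$. *)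

theory Defs
  imports "HOL-Probability.Probability"
begin

definition real_distr :: "real measure \<Rightarrow> bool" where
  "real_distr \<rho> \<longleftrightarrow> prob_space \<rho> \<and> sets \<rho> = sets borel"

definition tail :: "real measure \<Rightarrow> real \<Rightarrow> real" where
  "tail \<rho> x = measure \<rho> {x<..}"

fun conv_pow :: "real measure \<Rightarrow> nat \<Rightarrow> real measure" where
  "conv_pow \<rho> 0 = return borel 0"
| "conv_pow \<rho> (Suc n) = convolution \<rho> (conv_pow \<rho> n)"

definition mgf_finite :: "real measure \<Rightarrow> real \<Rightarrow> bool" where
  "mgf_finite \<rho> \<gamma> \<longleftrightarrow> (\<integral>\<^sup>+ x. ennreal (exp (\<gamma> * x)) \<partial>\<rho>) < \<infinity>"

definition mgf :: "real measure \<Rightarrow> real \<Rightarrow> real" where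
  "mgf \<rho> \<gamma> = (\<integral> x. exp (\<gamma> * x) \<partial>\<rho>)"

definition mgf_complex :: "real measure \<Rightarrow> real \<Rightarrow> real \<Rightarrow> complex" where
  "mgf_complex \<rho> \<gamma> z = (\<integral> x. exp ((complex_of_real \<gamma> + \<i> * complex_of_real z) * complex_of_real x) \<partial>\<rho>)"

definition class_L :: "real \<Rightarrow> real measure \<Rightarrow> bool" where
  "class_L \<gamma> \<rho> \<longleftrightarrow> (\<forall>x. tail \<rho> x > 0) \<and>
     (\<forall>a. ((\<lambda>x. tail \<rho> (x + a) / (exp (- \<gamma> * a) * tail \<rho> x)) \<longlongrightarrow> 1) at_top)"

definition class_S :: "real \<Rightarrow> real measure \<Rightarrow> bool" where
  "class_S \<gamma> \<rho> \<longleftrightarrow> class_L \<gamma> \<rho> \<and> mgf_finite \<rho> \<gamma> \<and>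
     ((\<lambda>x. tail (conv_pow \<rho> 2) x / (2 * mgf \<rho> \<gamma> * tail \<rho> x)) \<longlongrightarrow> 1) at_top"

end

theory Submission
  imports Defs
begin

text \<open>
  Let \<open>\<rho> = \<mu>\<^bsup>n*\<^esup>\<close> be in \<open>S(\<gamma>)\<close>. Since \<open>\<rho>\<close> is convolution equivalent, a large value of a convolution of
  measures whose tails are dominated by that of \<open>\<rho>\<close> is caused by a single large summand. By Helly's
  theorem the functions \<open>y \<mapsto> tail \<mu> (x + y) / tail \<rho> x\<close> have limit points \<open>m\<close> as \<open>x \<rightarrow> \<infinity>\<close>, and the
  one-big-jump principle turns \<open>\<rho> \<in> L(\<gamma>)\<close> into \<open>n \<integral> m (y - u) \<mu>\<^bsup>(n-1)*\<^esup>(du) = exp (- \<gamma> y)\<close> for all but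
  countably many \<open>y\<close>. So \<open>exp (\<gamma> y) m y\<close> minus a suitable constant is a bounded function annihilated by
  the measure \<open>exp (\<gamma> u) \<mu>\<^bsup>(n-1)*\<^esup>(du)\<close>, whose Fourier transform has no zero, and it vanishes by Wiener's
  theorem. Hence \<open>m\<close> does not depend on the choice of the limit point, \<open>tail \<mu> x / tail \<rho> x\<close> has a
  positive limit, and \<open>\<mu>\<close> inherits \<open>S(\<gamma>)\<close> from \<open>\<rho>\<close>.

  Wiener's theorem is reduced to a Bernstein inequality: if \<open>G\<close> is a Fejer mean of bandwidth \<open>\<delta>\<close>, then
  \<open>\<bar>G (x - u) - G x\<bar>\<close> is at most \<open>sup \<bar>G\<bar>\<close> times a quantity that tends to \<open>0\<close> with \<open>\<delta> u\<close>. If \<open>\<nu>\<close>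
  annihilates \<open>x \<mapsto> exp (i z x) G x\<close>, this bounds \<open>\<bar>G\<bar>\<close> times the modulus of the Fourier transform of
  \<open>\<nu>\<close> at \<open>- z\<close> by an arbitrarily small multiple of \<open>sup \<bar>G\<bar>\<close>, so that \<open>G = 0\<close>. Wide Fejer kernels are
  sums of modulated narrow ones, hence all Fejer means of an annihilated function vanish.
\<close>

section \<open>Fejer and de la Vallee Poussin kernels\<close>

text \<open>The Fejer kernel, normalised to the value 1 at 0, so that its mass is 2 pi. The form
  with \<open>sinc\<close> takes the right value at 0 without a case distinction.\<close>

definition fejer :: "real \<Rightarrow> real" where
  "fejer x = (sinc (x / 2))\<^sup>2"

lemma fejer_nonneg: "0 \<le> fejer x"
  by (simp add: fejer_def)

lemma fejer_0: "fejer 0 = 1"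
  by (simp add: fejer_def)

lemma isCont_fejer: "isCont fejer x"
proof -
  have "isCont (\<lambda>x. (sinc (x / 2))\<^sup>2) x"
    by (intro continuous_power continuous_within_compose3[OF isCont_sinc]) (auto intro!: continuous_intros)
  then show ?thesis
    by (simp add: fejer_def[abs_def])
qed

lemma borel_measurable_fejer[measurable]: "fejer \<in> borel_measurable borel"
  by (intro borel_measurable_continuous_onI continuous_at_imp_continuous_on ballI isCont_fejer)

lemma fejer_mult: "x\<^sup>2 * fejer x = 2 * (1 - cos x)"
proof -
  have "cos x = 1 - 2 * (sin (x / 2))\<^sup>2"
    using cos_double_sin[of "x / 2"] by simp
  then show ?thesis
    by (auto simp: fejer_def power2_eq_square)
qed

lemma fejer_eq: "x \<noteq> 0 \<Longrightarrow> fejer x = 2 * (1 - cos x) / x\<^sup>2"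
  using fejer_mult[of x] by (simp add: field_simps)

lemma fejer_minus: "fejer (- x) = fejer x"
  by (simp add: fejer_def)

text \<open>Integration by parts leads to the sine integral: on the positive half-line the
  antiderivative \<open>2 * Si x - 2 * (1 - cos x) / x\<close> grows from 0 to pi, and evenness
  doubles this.\<close>

lemma has_bochner_integral_fejer: "has_bochner_integral lborel fejer (2 * pi)"
proof -
  let ?F = "\<lambda>x. 2 * Si x - 2 * (1 - cos x) / x"
  have deriv: "DERIV ?F x :> fejer x" if "0 < x" for x
    using that fejer_eq[of x]
    by (auto intro!: derivative_eq_intros DERIV_Si simp: field_simps power2_eq_square)
  have lim0: "(?F \<longlongrightarrow> 0) (at_right 0)"
  proof -
    have "((\<lambda>x. (1 - cos x) / x :: real) \<longlongrightarrow> 0) (at_right 0)"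
      by real_asymp
    moreover have "(Si \<longlongrightarrow> Si 0) (at_right 0)"
      using isCont_Si[of 0] by (auto simp: isCont_def intro: tendsto_within_subset)
    ultimately have "((\<lambda>x. 2 * Si x - 2 * ((1 - cos x) / x)) \<longlongrightarrow> 2 * Si 0 - 2 * 0) (at_right 0)"
      by (intro tendsto_intros)
    moreover have "Si 0 = 0"
      by (simp add: Si_def zero_ereal_def[symmetric])
    ultimately show ?thesis by simp
  qed
  have limt: "(?F \<longlongrightarrow> pi) at_top"
  proof -
    have "((\<lambda>x. (1 - cos x) / x :: real) \<longlongrightarrow> 0) at_top"
      by real_asymp
    then have "((\<lambda>x. 2 * Si x - 2 * ((1 - cos x) / x)) \<longlongrightarrow> 2 * (pi / 2) - 2 * 0) at_top"
      by (intro tendsto_intros Si_at_top)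
    then show ?thesis by simp
  qed
  have A: "((?F \<circ> real_of_ereal) \<longlongrightarrow> 0) (at_right 0)"
    unfolding zero_ereal_def using lim0 by (simp add: ereal_tendsto_simps)
  have B: "((?F \<circ> real_of_ereal) \<longlongrightarrow> pi) (at_left \<infinity>)"
    using limt by (simp add: ereal_tendsto_simps)
  have "set_integrable lborel {0<..} fejer" and "(LBINT x=0..\<infinity>. fejer x) = pi - 0"
    using interval_integral_FTC_nonneg[OF _ _ _ _ A B, of fejer] deriv isCont_fejer fejer_nonneg
    by (auto simp: zero_ereal_def simp del: einterval_eq_Ici simp flip: einterval_eq_Ici)
  then have "has_bochner_integral lborel (\<lambda>x. indicator {0<..} x *\<^sub>R fejer x) pi"
    by (simp add: has_bochner_integral_iff set_integrable_def interval_lebesgue_integral_0_infty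
        set_lebesgue_integral_def flip: zero_ereal_def)
  \<comment> \<open>The rule for even functions starts from the closed half-line, hence the null set
    \<open>{0}\<close> is added.\<close>
  then have "has_bochner_integral lborel (\<lambda>x. indicator {0..} x *\<^sub>R fejer x) pi"
    by (rule has_bochner_integral_discrete_difference[where X="{0}", THEN iffD1, rotated 4])
       (auto simp: indicator_def)
  from has_bochner_integral_even_function[OF this] show ?thesis
    by (simp add: fejer_minus)
qed

lemma integrable_fejer: "integrable lborel fejer"
  using has_bochner_integral_fejer by (simp add: has_bochner_integral_iff)

text \<open>The factor \<open>a\<^sup>2\<close> turns the integrand into
  \<open>2 * (1 - cos (a * x)) / x\<^sup>2\<close> off 0 and makes the formula valid for
  \<open>a = 0\<close> as well.\<close>

lemma has_bochner_integral_fejer_scale: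
  "has_bochner_integral lborel (\<lambda>x. a\<^sup>2 * fejer (a * x)) (2 * pi * \<bar>a\<bar>)"
proof (cases "a = 0")
  case False
  then have "has_bochner_integral lborel (\<lambda>x. fejer (0 + a * x)) (2 * pi /\<^sub>R \<bar>a\<bar>)"
    using has_bochner_integral_fejer lborel_has_bochner_integral_real_affine_iff[of a fejer "2 * pi" 0] by blast
  from has_bochner_integral_mult_right[OF this, of "a\<^sup>2"] False show ?thesis
    by (simp add: power2_eq_square field_simps abs_if split: if_splits)
qed (simp add: has_bochner_integral_zero)

text \<open>The product formula for \<open>cos x * cos (t * x)\<close> splits the integrand into
  three rescaled kernels. The value is a second difference of the absolute value, that is the
  triangle \<open>2 * pi * max 0 (1 - \<bar>t\<bar>)\<close>.\<close>

lemma has_bochner_integral_fejer_cos: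
  "has_bochner_integral lborel (\<lambda>x. fejer x * cos (t * x)) (pi * (\<bar>1 + t\<bar> + \<bar>1 - t\<bar> - 2 * \<bar>t\<bar>))"
proof -
  have eq: "fejer x * cos (t * x) = ((1 + t)\<^sup>2 * fejer ((1 + t) * x) + (1 - t)\<^sup>2 * fejer ((1 - t) * x)) / 2
      - t\<^sup>2 * fejer (t * x)" for x
  proof (cases "x = 0")
    case True then show ?thesis by (simp add: fejer_0 power2_eq_square field_simps)
  next
    case False
    have m: "a\<^sup>2 * fejer (a * x) = 2 * (1 - cos (a * x)) / x\<^sup>2" for a
      using fejer_mult[of "a * x"] False by (simp add: field_simps power_mult_distrib)
    have c: "cos ((1 + t) * x) + cos ((1 - t) * x) = 2 * cos x * cos (t * x)"
      by (simp add: cos_add cos_diff algebra_simps)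
    have "((1 + t)\<^sup>2 * fejer ((1 + t) * x) + (1 - t)\<^sup>2 * fejer ((1 - t) * x)) / 2 - t\<^sup>2 * fejer (t * x)
      = (2 * cos (t * x) - (cos ((1 + t) * x) + cos ((1 - t) * x))) / x\<^sup>2"
      unfolding m by (simp add: diff_divide_distrib add_divide_distrib algebra_simps)
    also have "\<dots> = 2 * (1 - cos x) / x\<^sup>2 * cos (t * x)"
      unfolding c by (simp add: algebra_simps)
    finally show ?thesis
      using False by (simp add: fejer_eq)
  qed
  have "has_bochner_integral lborel (\<lambda>x. ((1 + t)\<^sup>2 * fejer ((1 + t) * x) + (1 - t)\<^sup>2 * fejer ((1 - t) * x)) / 2
      - t\<^sup>2 * fejer (t * x)) ((2 * pi * \<bar>1 + t\<bar> + 2 * pi * \<bar>1 - t\<bar>) / 2 - 2 * pi * \<bar>t\<bar>)"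
    by (intro has_bochner_integral_diff has_bochner_integral_divide has_bochner_integral_add has_bochner_integral_fejer_scale)
  moreover have "(2 * pi * \<bar>1 + t\<bar> + 2 * pi * \<bar>1 - t\<bar>) / 2 - 2 * pi * \<bar>t\<bar> = pi * (\<bar>1 + t\<bar> + \<bar>1 - t\<bar> - 2 * \<bar>t\<bar>)"
    by (simp add: field_simps)
  ultimately show ?thesis
    unfolding eq by simp
qed

text \<open>The Fourier transform of the de la Vallee Poussin kernel is \<open>1\<close> on \<open>[-1, 1]\<close>, where that of
  the Fejer kernel is supported; convolution with it therefore reproduces the Fejer kernel.\<close>
definition vallee :: "real \<Rightarrow> real" where
  "vallee x = (4 * fejer (2 * x) - fejer x) / (2 * pi)"

lemma borel_measurable_vallee[measurable]: "vallee \<in> borel_measurable borel"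
  unfolding vallee_def[abs_def] by measurable

lemma isCont_vallee: "isCont vallee x"
  unfolding vallee_def[abs_def]
  by (intro continuous_intros continuous_within_compose3[OF isCont_fejer]) auto

lemma integrable_vallee: "integrable lborel vallee"
  unfolding vallee_def[abs_def]
  using lborel_integrable_real_affine[OF integrable_fejer, of 2 0] integrable_fejer
  by (auto intro!: integrable_divide Bochner_Integration.integrable_diff integrable_mult_right)

lemma vallee_minus: "vallee (- x) = vallee x"
  using fejer_minus[of "2 * x"] by (simp add: vallee_def fejer_minus)

text \<open>The transform is a triangle of height 2 on [-2, 2] minus one of height 1 on [-1, 1]. On
  [-1, 1] both have the same slopes, so the difference is constant there.\<close>

lemma has_bochner_integral_vallee_cos:
  assumes "\<bar>t\<bar> \<le> 1"
  shows "has_bochner_integral lborel (\<lambda>x. vallee x * cos (t * x)) 1"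
proof -
  have "has_bochner_integral lborel (\<lambda>x. fejer (0 + 2 * x) * cos (t / 2 * (0 + 2 * x)))
     (pi * (\<bar>1 + t / 2\<bar> + \<bar>1 - t / 2\<bar> - 2 * \<bar>t / 2\<bar>) /\<^sub>R \<bar>2\<bar>)"
    using has_bochner_integral_fejer_cos[of "t / 2"]
    by (subst (asm) lborel_has_bochner_integral_real_affine_iff[of 2 _ _ 0]) auto
  from has_bochner_integral_divide[OF has_bochner_integral_diff[OF
      has_bochner_integral_mult_right[OF this, of 4] has_bochner_integral_fejer_cos[of t]], of "2 * pi"]
  have "has_bochner_integral lborel (\<lambda>x. (4 * (fejer (0 + 2 * x) * cos (t / 2 * (0 + 2 * x))) - fejer x * cos (t * x)) / (2 * pi))
    ((4 * (pi * (\<bar>1 + t / 2\<bar> + \<bar>1 - t / 2\<bar> - 2 * \<bar>t / 2\<bar>) /\<^sub>R \<bar>2\<bar>) - pi * (\<bar>1 + t\<bar> + \<bar>1 - t\<bar> - 2 * \<bar>t\<bar>)) / (2 * pi))"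
    by blast
  moreover have "(\<lambda>x. (4 * (fejer (0 + 2 * x) * cos (t / 2 * (0 + 2 * x))) - fejer x * cos (t * x)) / (2 * pi)) = (\<lambda>x. vallee x * cos (t * x))"
    by (simp add: vallee_def fun_eq_iff diff_divide_distrib left_diff_distrib)
  moreover have "\<bar>1 + t / 2\<bar> = 1 + t / 2" "\<bar>1 - t / 2\<bar> = 1 - t / 2" "\<bar>1 + t\<bar> = 1 + t" "\<bar>1 - t\<bar> = 1 - t" "\<bar>t / 2\<bar> = \<bar>t\<bar> / 2"
    using assms by linarith+
  moreover have "(4 * (pi * (1 + t / 2 + (1 - t / 2) - 2 * (\<bar>t\<bar> / 2)) /\<^sub>R \<bar>2\<bar>) - pi * (1 + t + (1 - t) - 2 * \<bar>t\<bar>)) / (2 * pi) = 1"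
    by (simp add: field_simps)
  ultimately show ?thesis by simp
qed

lemma integrable_bounded_mult:
  fixes f g :: "'a \<Rightarrow> 'b::{banach, second_countable_topology, real_normed_field}"
  assumes "integrable M f" and [measurable]: "g \<in> borel_measurable M" and "\<And>x. norm (g x) \<le> B"
  shows "integrable M (\<lambda>x. f x * g x)"
proof (rule Bochner_Integration.integrable_bound)
  show "integrable M (\<lambda>x. B *\<^sub>R norm (f x))"
    using assms by auto
  have "0 \<le> B" using assms(3) norm_ge_zero order_trans by blast
  then show "AE x in M. norm (f x * g x) \<le> norm (B *\<^sub>R norm (f x))"
    using assms(3) by (auto simp: norm_mult mult.commute[of B] intro!: mult_left_mono)
  show "(\<lambda>x. f x * g x) \<in> borel_measurable M"
    using borel_measurable_integrable[OF assms(1)] by measurable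
qed

lemma has_bochner_integral_vallee_sin:
  "has_bochner_integral lborel (\<lambda>x. vallee x * sin (t * x)) 0"
proof -
  have i: "integrable lborel (\<lambda>x. vallee x * sin (t * x))"
    by (rule integrable_bounded_mult[OF integrable_vallee, where B=1]) auto
  have "(\<integral>x. vallee x * sin (t * x) \<partial>lborel) = (\<integral>x. vallee (0 + (-1) * x) * sin (t * (0 + (-1) * x)) \<partial>lborel)"
    by (subst lborel_integral_real_affine[of "-1" _ 0]) auto
  also have "\<dots> = - (\<integral>x. vallee x * sin (t * x) \<partial>lborel)"
    by (simp add: vallee_minus)
  finally show ?thesis
    using i by (simp add: has_bochner_integral_iff)
qed

lemma integral_vallee_cos_diff:
  assumes "\<bar>t\<bar> \<le> 1"
  shows "(\<integral>s. vallee s * cos (t * (x - s)) \<partial>lborel) = cos (t * x)"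
proof -
  have "has_bochner_integral lborel (\<lambda>s. vallee s * cos (t * s) * cos (t * x) + vallee s * sin (t * s) * sin (t * x)) (1 * cos (t * x) + 0 * sin (t * x))"
    by (intro has_bochner_integral_add has_bochner_integral_mult_left
        has_bochner_integral_vallee_cos has_bochner_integral_vallee_sin assms)
  then show ?thesis
    by (simp add: has_bochner_integral_iff cos_diff algebra_simps)
qed

text \<open>Fourier inversion for the triangle. As a superposition of frequencies in [0, 1], the
  kernel can be convolved with \<open>vallee\<close> one frequency at a time.\<close>

lemma fejer_eq_integral_cos: "fejer x = (LBINT t:{0..1}. 2 * (1 - t) * cos (t * x))"
proof (cases "x = 0")
  case True
  have "(LBINT t:{0..1}. 2 * (1 - t)) = (2 * 1 - 1\<^sup>2) - (2 * 0 - 0\<^sup>2 :: real)"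
    unfolding set_lebesgue_integral_def
    by (intro integral_FTC_atLeastAtMost[where F = "\<lambda>t. 2 * t - t\<^sup>2"])
       (auto intro!: derivative_eq_intros continuous_intros
         simp flip: has_real_derivative_iff_has_vector_derivative)
  with True show ?thesis by (simp add: fejer_0)
next
  case False
  have "(LBINT t:{0..1}. 2 * (1 - t) * cos (t * x)) =
    (2 * (1 - 1) * sin (1 * x) / x - 2 * cos (1 * x) / x\<^sup>2) - (2 * (1 - 0) * sin (0 * x) / x - 2 * cos (0 * x) / x\<^sup>2)"
    unfolding set_lebesgue_integral_def using False
    by (intro integral_FTC_atLeastAtMost[where F = "\<lambda>t. 2 * (1 - t) * sin (t * x) / x - 2 * cos (t * x) / x\<^sup>2"])
       (auto intro!: derivative_eq_intros continuous_intros simp: field_simps power2_eq_square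
         simp flip: has_real_derivative_iff_has_vector_derivative)
  with False show ?thesis by (simp add: fejer_eq field_simps)
qed

text \<open>By Fubini the convolution acts on each frequency of the Fejer kernel separately, and
  every frequency up to 1 is reproduced.\<close>

lemma vallee_convolution_fejer: "(\<integral>s. vallee s * fejer (x - s) \<partial>lborel) = fejer x"
proof -
  let ?f = "\<lambda>(s, t). indicator {0..1} t * (2 * (1 - t)) * (vallee s * cos (t * (x - s))) :: real"
  have "integrable (lborel \<Otimes>\<^sub>M lborel) ?f"
  proof (rule lborel_pair.Fubini_integrable)
    show "?f \<in> borel_measurable (lborel \<Otimes>\<^sub>M lborel)" by measurable
    have *: "integrable lborel (\<lambda>t. indicator {0..1} t * (2 * (1 - t)) :: real)"
      using borel_integrable_atLeastAtMost'[of 0 1 "\<lambda>t. 2 * (1 - t) :: real"]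
      by (simp add: set_integrable_def continuous_on_diff continuous_on_mult_left)
    have **: "integrable lborel (\<lambda>t. indicator {0..1} t * (2 * (1 - t)) * (cos (t * (x - s))) :: real)" for s
      by (rule integrable_bounded_mult[OF *, where B=1]) auto
    show "AE s in lborel. integrable lborel (\<lambda>t. ?f (s, t))"
      using integrable_mult_right[OF **] by (simp add: mult_ac)
    show "integrable lborel (\<lambda>s. \<integral>t. norm (?f (s, t)) \<partial>lborel)"
    proof (rule Bochner_Integration.integrable_bound)
      show "integrable lborel (\<lambda>s. vallee s * (\<integral>t. norm (indicator {0..1} t * (2 * (1 - t)) :: real) \<partial>lborel))"
        by (intro integrable_mult_left integrable_vallee)
      show "(\<lambda>s. \<integral>t. norm (?f (s, t)) \<partial>lborel) \<in> borel_measurable lborel"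
        by measurable
      have "(\<integral>t. norm (?f (s, t)) \<partial>lborel) \<le> \<bar>vallee s\<bar> * (\<integral>t. norm (indicator {0..1} t * (2 * (1 - t)) :: real) \<partial>lborel)" for s
      proof (subst Bochner_Integration.integral_mult_right_zero[symmetric], rule integral_mono)
        show "integrable lborel (\<lambda>t. norm (?f (s, t)))"
          using integrable_norm[OF integrable_mult_right[OF **[of s], of "vallee s"]] by (simp add: mult_ac)
        show "integrable lborel (\<lambda>t. \<bar>vallee s\<bar> * norm (indicator {0..1} t * (2 * (1 - t)) :: real))"
          using * by auto
        show "norm (?f (s, t)) \<le> \<bar>vallee s\<bar> * norm (indicator {0..1} t * (2 * (1 - t)) :: real)" for t
          by (auto simp: abs_mult mult.commute[of _ "\<bar>vallee s\<bar>"] mult.left_commute[of _ "\<bar>vallee s\<bar>"] mult_left_le split: split_indicator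
             intro!: mult_left_mono)
      qed
      then show "AE s in lborel. norm (\<integral>t. norm (?f (s, t)) \<partial>lborel) \<le> norm (vallee s * (\<integral>t. norm (indicator {0..1} t * (2 * (1 - t)) :: real) \<partial>lborel))"
        by (auto simp: abs_mult)
    qed
  qed
  from lborel_pair.Fubini_integral[OF this]
  have "(\<integral>s. (\<integral>t. ?f (s, t) \<partial>lborel) \<partial>lborel) = (\<integral>t. (\<integral>s. ?f (s, t) \<partial>lborel) \<partial>lborel)"
    by simp
  also have "(\<lambda>s. \<integral>t. ?f (s, t) \<partial>lborel) = (\<lambda>s. vallee s * fejer (x - s))"
    unfolding fejer_eq_integral_cos set_lebesgue_integral_def
    by (auto simp: fun_eq_iff simp flip: Bochner_Integration.integral_mult_right_zero intro!: Bochner_Integration.integral_cong)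
  also have "(\<lambda>t. \<integral>s. ?f (s, t) \<partial>lborel) = (\<lambda>t. indicator {0..1} t *\<^sub>R (2 * (1 - t) * cos (t * x)))"
    by (auto simp: fun_eq_iff integral_vallee_cos_diff split: split_indicator)
  finally show ?thesis
    by (simp add: fejer_eq_integral_cos[of x] set_lebesgue_integral_def)
qed

section \<open>Wiener's theorem for bounded functions\<close>

text \<open>The modulus of continuity in L1 of the kernel. It is the quantity that replaces a
  derivative in the Bernstein inequality below.\<close>

definition vallee_modulus :: "real \<Rightarrow> real" where
  "vallee_modulus u = (\<integral>s. \<bar>vallee (s - u) - vallee s\<bar> \<partial>lborel)"

lemma borel_measurable_vallee_modulus[measurable]: "vallee_modulus \<in> borel_measurable borel"
  unfolding vallee_modulus_def[abs_def] by measurable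

lemma integrable_vallee_shift: "integrable lborel (\<lambda>s. vallee (s - u))"
  using lborel_integrable_real_affine[OF integrable_vallee, of 1 "- u"] by simp

lemma integral_vallee_shift: "(\<integral>s. \<bar>vallee (s - u)\<bar> \<partial>lborel) = (\<integral>s. \<bar>vallee s\<bar> \<partial>lborel)"
  using lborel_integral_real_affine[of 1 "\<lambda>s. \<bar>vallee s\<bar>" "- u"] by simp

lemma vallee_modulus_nonneg: "0 \<le> vallee_modulus u"
  by (simp add: vallee_modulus_def)

lemma vallee_modulus_le: "vallee_modulus u \<le> 2 * (\<integral>s. \<bar>vallee s\<bar> \<partial>lborel)"
proof -
  have "vallee_modulus u \<le> (\<integral>s. \<bar>vallee (s - u)\<bar> + \<bar>vallee s\<bar> \<partial>lborel)"
    unfolding vallee_modulus_def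
    by (intro integral_mono) (auto intro!: integrable_abs Bochner_Integration.integrable_add
        Bochner_Integration.integrable_diff integrable_vallee integrable_vallee_shift)
  also have "\<dots> = 2 * (\<integral>s. \<bar>vallee s\<bar> \<partial>lborel)"
    by (subst Bochner_Integration.integral_add)
       (auto intro!: integrable_abs integrable_vallee integrable_vallee_shift simp: integral_vallee_shift)
  finally show ?thesis .
qed

text \<open>An integrable majorant for dominated convergence. It comes from
  \<open>fejer y \<le> 1\<close> near 0 and \<open>fejer y * y\<^sup>2 \<le> 4\<close> far away; the
  constant 25 is not sharp.\<close>

lemma abs_vallee_le: "\<bar>vallee x\<bar> \<le> 25 * inverse (1 + x\<^sup>2)"
proof -
  have "(sin y)\<^sup>2 \<le> y\<^sup>2" for y :: real
    using abs_sin_x_le_abs_x[of y] abs_le_square_iff by blast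
  from this[of "y / 2" for y] have 1: "fejer y \<le> 1" for y
    by (auto simp: fejer_def power_divide divide_le_eq)
  have 2: "fejer y * y\<^sup>2 \<le> 4" for y
    using fejer_mult[of y] cos_ge_minus_one[of y] by (smt (verit) mult.commute)
  have "(4 * fejer (2 * x) + fejer x) * (1 + x\<^sup>2) \<le> 25"
    using 1[of x] 2[of x] 1[of "2 * x"] 2[of "2 * x"] by (simp add: algebra_simps power_mult_distrib)
  moreover have "\<bar>4 * fejer (2 * x) - fejer x\<bar> \<le> 4 * fejer (2 * x) + fejer x"
    using fejer_nonneg[of x] fejer_nonneg[of "2 * x"] by linarith
  moreover have "\<bar>vallee x\<bar> \<le> \<bar>4 * fejer (2 * x) - fejer x\<bar>"
    using pi_gt3 by (auto simp: vallee_def abs_mult divide_le_eq mult_le_cancel_left1)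
  ultimately have "\<bar>vallee x\<bar> * (1 + x\<^sup>2) \<le> 25"
    by (smt (verit, best) mult_right_mono zero_le_power2)
  moreover have "0 < 1 + x\<^sup>2" by (simp add: add_pos_nonneg)
  ultimately show ?thesis by (simp add: field_simps)
qed

lemma borel_measurable_cis[measurable]: "cis \<in> borel_measurable borel"
  by (intro borel_measurable_continuous_onI continuous_intros)

text \<open>Continuity of translation in L1. As the kernel is continuous, it suffices to dominate
  all the translates at once.\<close>

lemma vallee_modulus_tendsto_0:
  assumes "X \<longlonglongrightarrow> 0"
  shows "(\<lambda>n. vallee_modulus (X n)) \<longlonglongrightarrow> 0"
proof -
  have "Bseq X"
    using assms by (intro convergent_imp_Bseq convergentI)
  then obtain B where B: "\<And>n. \<bar>X n\<bar> \<le> B"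
    by (auto simp: Bseq_def)
  \<comment> \<open>Shifts of size at most \<open>B\<close> change the weight by a bounded factor:
    \<open>1 + s\<^sup>2 \<le> (2 + 2 * B\<^sup>2) * (1 + (s - X n)\<^sup>2)\<close>.\<close>
  let ?w = "\<lambda>s::real. 25 * (2 + 2 * B\<^sup>2) * inverse (1 + s\<^sup>2) + 25 * inverse (1 + s\<^sup>2)"
  have bound: "norm \<bar>vallee (s - X n) - vallee s\<bar> \<le> ?w s" for n s
  proof -
    have "(X n)\<^sup>2 \<le> B\<^sup>2"
      using B[of n] by (metis abs_le_square_iff abs_of_nonneg abs_ge_zero order_trans)
    moreover have "1 + s\<^sup>2 \<le> 1 + 2 * (s - X n)\<^sup>2 + 2 * (X n)\<^sup>2"
      using zero_le_power2[of "s - 2 * X n"] by (simp add: power2_eq_square algebra_simps)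
    moreover have "0 \<le> B\<^sup>2 * (s - X n)\<^sup>2" by simp
    moreover have "(2 + 2 * B\<^sup>2) * (1 + (s - X n)\<^sup>2) = 2 + 2 * B\<^sup>2 + 2 * (s - X n)\<^sup>2 + 2 * (B\<^sup>2 * (s - X n)\<^sup>2)"
      by (simp add: algebra_simps)
    ultimately have "1 + s\<^sup>2 \<le> (2 + 2 * B\<^sup>2) * (1 + (s - X n)\<^sup>2)"
      by linarith
    moreover have "0 < 1 + s\<^sup>2" "0 < 1 + (s - X n)\<^sup>2"
      by (auto simp: add_pos_nonneg)
    ultimately have "25 * inverse (1 + (s - X n)\<^sup>2) \<le> 25 * (2 + 2 * B\<^sup>2) * inverse (1 + s\<^sup>2)"
      by (simp add: field_simps)
    moreover have "\<bar>vallee (s - X n) - vallee s\<bar> \<le> \<bar>vallee (s - X n)\<bar> + \<bar>vallee s\<bar>"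
      by linarith
    ultimately show ?thesis
      using abs_vallee_le[of "s - X n"] abs_vallee_le[of s] unfolding real_norm_def abs_abs by linarith
  qed
  have "(\<lambda>n. \<integral>s. \<bar>vallee (s - X n) - vallee s\<bar> \<partial>lborel) \<longlonglongrightarrow> (\<integral>s. 0 \<partial>(lborel :: real measure))"
  proof (rule integral_dominated_convergence)
    show "integrable lborel ?w"
      using integrable_inverse_1_plus_square by (auto simp: set_integrable_def)
    show "AE s in lborel. norm \<bar>vallee (s - X n) - vallee s\<bar> \<le> ?w s" for n
      using bound by blast
    have "(\<lambda>n. \<bar>vallee (s - X n) - vallee s\<bar>) \<longlonglongrightarrow> \<bar>vallee (s - 0) - vallee s\<bar>" for s
      by (intro tendsto_intros isCont_tendsto_compose[OF isCont_vallee] assms)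
    then show "AE s in lborel. (\<lambda>n. \<bar>vallee (s - X n) - vallee s\<bar>) \<longlonglongrightarrow> 0"
      by simp
  qed measurable
  then show ?thesis by (simp add: vallee_modulus_def)
qed

text \<open>A common justification for the applications of Fubini below: a shift of \<open>K\<close>
  by \<open>c s\<close> leaves its L1 norm unchanged, so the norms factor, and the bounded factor
  \<open>H\<close> does no harm. Both Lebesgue measure with \<open>c s = s\<close> and a finite
  measure with \<open>c s = 0\<close> occur.\<close>

lemma integrable_pair_shift_mult:
  fixes V K :: "real \<Rightarrow> complex" and H :: "real \<times> real \<Rightarrow> complex"
  assumes "sigma_finite_measure M" and [measurable_cong]: "sets M = sets borel"
    and V: "integrable M V" and K: "integrable lborel K"
    and [measurable]: "c \<in> borel_measurable borel"
    and [measurable]: "H \<in> borel_measurable (borel \<Otimes>\<^sub>M borel)" and H: "\<And>p. norm (H p) \<le> B"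
  shows "integrable (M \<Otimes>\<^sub>M lborel) (\<lambda>(s, w). V s * K (w - c s) * H (s, w))"
proof -
  interpret M: sigma_finite_measure M by fact
  interpret pair_sigma_finite M lborel ..
  have [measurable]: "V \<in> borel_measurable borel" "K \<in> borel_measurable borel"
    using V K borel_measurable_integrable[of M V] borel_measurable_integrable[of lborel K]
    by (auto simp: measurable_cong_sets[OF assms(2) refl])
  have shift: "integrable lborel (\<lambda>w. K (w - a))" for a
    using lborel_integrable_real_affine[OF K, of 1 "- a"] by simp
  have "integrable (M \<Otimes>\<^sub>M lborel) (\<lambda>(s, w). V s * K (w - c s))"
  proof (rule Fubini_integrable)
    show "(\<lambda>(s, w). V s * K (w - c s)) \<in> borel_measurable (M \<Otimes>\<^sub>M lborel)"
      by measurable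
    have "(\<integral>w. norm (K (w - a)) \<partial>lborel) = (\<integral>w. norm (K w) \<partial>lborel)" for a
      using lborel_integral_real_affine[of 1 "\<lambda>w. norm (K w)" "- a"] by simp
    then show "integrable M (\<lambda>s. \<integral>w. norm (case (s, w) of (s, w) \<Rightarrow> V s * K (w - c s)) \<partial>lborel)"
      using V by (simp add: norm_mult)
    show "AE s in M. integrable lborel (\<lambda>w. case (s, w) of (s, w) \<Rightarrow> V s * K (w - c s))"
      using shift by auto
  qed
  from integrable_bounded_mult[OF this _ H] show ?thesis
    by (simp add: case_prod_unfold)
qed

section \<open>Fejer means of bounded functions and the Bernstein inequality\<close>

lemma integrable_fejer_scale: "\<delta> \<noteq> 0 \<Longrightarrow> integrable lborel (\<lambda>w. complex_of_real (fejer (\<delta> * w)))"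
  using lborel_integrable_real_affine[OF integrable_fejer, of \<delta> 0] by simp

lemma integrable_fejer_scale_mult:
  fixes H :: "real \<Rightarrow> complex"
  assumes "\<delta> \<noteq> 0" "H \<in> borel_measurable borel" "\<And>x. norm (H x) \<le> B"
  shows "integrable lborel (\<lambda>w. fejer (\<delta> * w) * H w)"
  by (rule integrable_bounded_mult[OF integrable_fejer_scale, where B=B]) (use assms in auto)

text \<open>Associativity of convolution: the mean \<open>G\<close> inherits the reproduction by
  \<open>vallee\<close> from the Fejer kernel.\<close>

lemma fejer_mean_eq_vallee_mean:
  fixes G H :: "real \<Rightarrow> complex"
  assumes [measurable]: "H \<in> borel_measurable borel" and H: "\<And>x. norm (H x) \<le> B"
  defines "G \<equiv> \<lambda>x. \<integral>w. fejer w * H (x - w) \<partial>lborel"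
  shows "(\<integral>s. vallee s * G (x - s) \<partial>lborel) = G x"
proof -
  have G: "G (x - s) = (\<integral>w. fejer (w - s) * H (x - w) \<partial>lborel)" for s
    unfolding G_def using lborel_integral_real_affine[of 1 "\<lambda>w. fejer w * H (x - s - w)" "- s"] by simp
  let ?f = "\<lambda>(s, w). complex_of_real (vallee s) * complex_of_real (fejer (w - s)) * H (x - w)"
  have "integrable (lborel \<Otimes>\<^sub>M lborel) ?f"
    using integrable_pair_shift_mult[of lborel "\<lambda>s. complex_of_real (vallee s)" "\<lambda>w. complex_of_real (fejer w)"
       "\<lambda>s. s" "\<lambda>(s, w). H (x - w)" B] H integrable_vallee integrable_fejer
    by (simp add: lborel.sigma_finite_measure_axioms case_prod_unfold)
  from lborel_pair.Fubini_integral[OF this]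
  have "(\<integral>s. (\<integral>w. ?f (s, w) \<partial>lborel) \<partial>lborel) = (\<integral>w. (\<integral>s. ?f (s, w) \<partial>lborel) \<partial>lborel)"
    by simp
  also have "(\<lambda>s. \<integral>w. ?f (s, w) \<partial>lborel) = (\<lambda>s. vallee s * G (x - s))"
    by (simp add: fun_eq_iff G mult.assoc)
  also have "(\<lambda>w. \<integral>s. ?f (s, w) \<partial>lborel) = (\<lambda>w. fejer w * H (x - w))"
  proof
    fix w
    have "(\<integral>s. ?f (s, w) \<partial>lborel) = (\<integral>s. complex_of_real (vallee s * fejer (w - s)) \<partial>lborel) * H (x - w)"
      by simp
    also have "\<dots> = fejer w * H (x - w)"
      unfolding integral_complex_of_real vallee_convolution_fejer ..
    finally show "(\<integral>s. ?f (s, w) \<partial>lborel) = fejer w * H (x - w)" .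
  qed
  finally show ?thesis by (simp add: G_def)
qed

text \<open>In the reproducing formula the shift of \<open>G\<close> can be moved onto the kernel,
  so that the difference is an integral of \<open>vallee (s - u) - vallee s\<close> against
  \<open>G (x - s)\<close>. What matters is that the bound involves \<open>C\<close>, a bound of
  \<open>G\<close> itself, and not the bound \<open>B\<close> of \<open>H\<close>.\<close>

lemma fejer_mean_bernstein_unit:
  fixes G H :: "real \<Rightarrow> complex"
  assumes [measurable]: "H \<in> borel_measurable borel" and H: "\<And>x. norm (H x) \<le> B"
  defines "G \<equiv> \<lambda>x. \<integral>w. fejer w * H (x - w) \<partial>lborel"
  assumes G: "\<And>x. norm (G x) \<le> C"
  shows "norm (G (x - u) - G x) \<le> C * vallee_modulus u"
proof -
  have [measurable]: "G \<in> borel_measurable borel"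
    unfolding G_def by measurable
  have int: "integrable lborel (\<lambda>s. complex_of_real (vallee (s - a)) * G (x - s))" for a
    by (rule integrable_bounded_mult[of _ _ _ C]) (use integrable_vallee_shift G in auto)
  have "G (x - u) = (\<integral>s. vallee s * G (x - u - s) \<partial>lborel)"
    unfolding G_def by (rule fejer_mean_eq_vallee_mean[symmetric]) (use H in auto)
  also have "\<dots> = (\<integral>s. vallee (s - u) * G (x - s) \<partial>lborel)"
    using lborel_integral_real_affine[of 1 "\<lambda>s. vallee s * G (x - u - s)" "- u"] by simp
  moreover have "G x = (\<integral>s. vallee s * G (x - s) \<partial>lborel)"
    unfolding G_def by (rule fejer_mean_eq_vallee_mean[symmetric]) (use H in auto)
  ultimately have "G (x - u) - G x = (\<integral>s. vallee (s - u) * G (x - s) - vallee s * G (x - s) \<partial>lborel)"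
    using int[of u] int[of 0] by simp
  also have "norm \<dots> \<le> (\<integral>s. C * \<bar>vallee (s - u) - vallee s\<bar> \<partial>lborel)"
  proof (rule Bochner_Integration.integral_norm_bound_integral)
    show "integrable lborel (\<lambda>s. vallee (s - u) * G (x - s) - vallee s * G (x - s))"
      using int[of u] int[of 0] by simp
    show "integrable lborel (\<lambda>s. C * \<bar>vallee (s - u) - vallee s\<bar>)"
      using integrable_vallee_shift[of u] integrable_vallee by simp
    show "norm (vallee (s - u) * G (x - s) - vallee s * G (x - s)) \<le> C * \<bar>vallee (s - u) - vallee s\<bar>" for s
      unfolding left_diff_distrib[symmetric] of_real_diff[symmetric] norm_mult norm_of_real
      using mult_right_mono[OF G, of "\<bar>vallee (s - u) - vallee s\<bar>"] by (simp add: mult.commute)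
  qed
  also have "\<dots> = C * vallee_modulus u"
    by (simp add: vallee_modulus_def)
  finally show ?thesis .
qed

text \<open>Rescaling the argument by \<open>\<delta>\<close> reduces this to bandwidth 1.\<close>

lemma fejer_mean_bernstein:
  fixes G H :: "real \<Rightarrow> complex"
  assumes \<delta>: "0 < \<delta>" and [measurable]: "H \<in> borel_measurable borel" and H: "\<And>x. norm (H x) \<le> B"
  defines "G \<equiv> \<lambda>x. \<integral>w. fejer (\<delta> * w) * H (x - w) \<partial>lborel"
  assumes G: "\<And>x. norm (G x) \<le> C"
  shows "norm (G (x - u) - G x) \<le> C * vallee_modulus (\<delta> * u)"
proof -
  define G' where "G' = (\<lambda>x. \<integral>w. fejer w * H ((x - w) / \<delta>) \<partial>lborel)"
  have G': "G' x = \<delta> * G (x / \<delta>)" for x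
    unfolding G_def G'_def
    using lborel_integral_real_affine[of \<delta> "\<lambda>w. fejer w * H ((x - w) / \<delta>)" 0] \<delta>
    by (simp add: scaleR_conv_of_real diff_divide_distrib)
  have "norm (G' (\<delta> * x - \<delta> * u) - G' (\<delta> * x)) \<le> (\<delta> * C) * vallee_modulus (\<delta> * u)"
    unfolding G'_def
  proof (rule fejer_mean_bernstein_unit[of "\<lambda>x. H (x / \<delta>)" B])
    show "norm (\<integral>w. fejer w * H ((x - w) / \<delta>) \<partial>lborel) \<le> \<delta> * C" for x
      using G' G \<delta> unfolding G'_def by (simp add: norm_mult)
  qed (use H in auto)
  also have "G' (\<delta> * x - \<delta> * u) - G' (\<delta> * x) = \<delta> * (G (x - u) - G x)"
    using \<delta> by (simp add: G' algebra_simps diff_divide_distrib)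
  finally show ?thesis
    using \<delta> by (simp add: norm_mult)
qed

text \<open>By Fubini the modulated mean \<open>E\<close> is annihilated by \<open>\<nu>\<close>
  like \<open>D\<close>, and \<open>E x = cis (z * x) * G x\<close> with a plain Fejer mean
  \<open>G\<close>. Replacing \<open>G (x - u)\<close> by \<open>G x\<close> in this relation costs
  at most \<open>S * ?I\<close>, where \<open>S\<close> is the supremum of the modulus of
  \<open>G\<close>. Hence \<open>S * norm ?c \<le> S * ?I\<close>, and \<open>?I < norm ?c\<close>
  leaves only \<open>S = 0\<close>.\<close>

lemma fejer_mean_eq_0_of_small_band:
  fixes D :: "real \<Rightarrow> complex"
  assumes "finite_measure \<nu>" and sets: "sets \<nu> = sets borel"
    and [measurable]: "D \<in> borel_measurable borel" and D: "\<And>x. norm (D x) \<le> B"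
    and N: "countable N" "\<And>y. y \<notin> N \<Longrightarrow> (\<integral>u. D (y - u) \<partial>\<nu>) = 0"
    and \<delta>: "0 < \<delta>"
    and small: "(\<integral>u. vallee_modulus (\<delta> * u) \<partial>\<nu>) < norm (\<integral>u. cis (- z * u) \<partial>\<nu>)"
  shows "(\<integral>w. fejer (\<delta> * w) * cis (z * w) * D (x - w) \<partial>lborel) = 0"
proof -
  interpret finite_measure \<nu> by fact
  interpret pair_sigma_finite \<nu> lborel ..
  note [measurable_cong] = sets
  define E where "E = (\<lambda>x. \<integral>w. fejer (\<delta> * w) * cis (z * w) * D (x - w) \<partial>lborel)"
  define G where "G = (\<lambda>x. \<integral>w. fejer (\<delta> * w) * (cis (- z * (x - w)) * D (x - w)) \<partial>lborel)"
  have [measurable]: "G \<in> borel_measurable borel"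
    unfolding G_def by measurable
  have EG: "E x = cis (z * x) * G x" for x
    unfolding E_def G_def integral_mult_right_zero[symmetric]
    by (intro Bochner_Integration.integral_cong) (auto simp: cis_mult algebra_simps)
  have intK: "integrable lborel (\<lambda>w. fejer (\<delta> * w) * cis (z * w))"
    by (rule integrable_fejer_scale_mult[where B=1]) (use \<delta> in auto)

  let ?f = "\<lambda>x (u, w). fejer (\<delta> * w) * cis (z * w) * D (x - w - u)"
  have "(\<integral>u. E (x - u) \<partial>\<nu>) = 0" for x
  proof -
    have "integrable (\<nu> \<Otimes>\<^sub>M lborel) (?f x)"
      using integrable_pair_shift_mult[OF finite_measure.sigma_finite_measure[OF assms(1)] sets, of "\<lambda>_. 1"
          "\<lambda>w. fejer (\<delta> * w) * cis (z * w)" "\<lambda>_. 0" "\<lambda>(u, w). D (x - w - u)" B] D intK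
      by (simp add: case_prod_unfold)
    from Fubini_integral[OF this]
    have "(\<integral>u. (\<integral>w. ?f x (u, w) \<partial>lborel) \<partial>\<nu>) = (\<integral>w. (\<integral>u. ?f x (u, w) \<partial>\<nu>) \<partial>lborel)"
      by simp
    also have "\<dots> = (\<integral>w. fejer (\<delta> * w) * cis (z * w) * (\<integral>u. D (x - w - u) \<partial>\<nu>) \<partial>lborel)"
      by simp
    also have "\<dots> = (\<integral>w. 0 \<partial>(lborel :: real measure))"
    proof (rule integral_cong_AE)
      \<comment> \<open>The reflected exceptional set is countable, hence invisible to the Lebesgue
        integral over \<open>w\<close>.\<close>
      have "countable ((\<lambda>y. x - y) ` N)"
        using N by auto
      from AE_not_in[OF countable_imp_null_set_lborel[OF this]]
      show "AE w in lborel. fejer (\<delta> * w) * cis (z * w) * (\<integral>u. D (x - w - u) \<partial>\<nu>) = 0"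
      proof eventually_elim
        case (elim w)
        then have "x - w \<notin> N" by force
        then show ?case using N by simp
      qed
    qed measurable
    finally show ?thesis
      by (simp add: E_def cancel_ab_semigroup_add_class.diff_right_commute[of x])
  qed
  then have G0: "(\<integral>u. cis (- z * u) * G (x - u) \<partial>\<nu>) = 0" for x
  proof -
    have "cis (z * (x - u)) = cis (z * x) * cis (- z * u)" for u
      by (simp add: cis_mult right_diff_distrib)
    then have "(\<integral>u. cis (z * x) * (cis (- z * u) * G (x - u)) \<partial>\<nu>) = (\<integral>u. E (x - u) \<partial>\<nu>)"
      by (simp only: EG mult.assoc)
    with \<open>(\<integral>u. E (x - u) \<partial>\<nu>) = 0\<close> show ?thesis
      by (simp del: mult_minus_left)
  qed

  have bdd: "norm (G x) \<le> B * (\<integral>w. fejer (\<delta> * w) \<partial>lborel)" for x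
  proof -
    have "norm (G x) \<le> (\<integral>w. fejer (\<delta> * w) * B \<partial>lborel)"
      unfolding G_def
    proof (rule Bochner_Integration.integral_norm_bound_integral)
      show "integrable lborel (\<lambda>w. fejer (\<delta> * w) * (cis (- z * (x - w)) * D (x - w)))"
        by (rule integrable_fejer_scale_mult[where B=B]) (use \<delta> D in \<open>auto simp: norm_mult\<close>)
      show "integrable lborel (\<lambda>w. fejer (\<delta> * w) * B)"
        using integrable_fejer_scale[of \<delta>] \<delta> by (simp add: complex_of_real_integrable_eq)
    qed (use D fejer_nonneg in \<open>auto simp: norm_mult intro!: mult_left_mono\<close>)
    then show ?thesis by (simp add: mult.commute)
  qed
  define S where "S = (SUP x. norm (G x))"
  have GS: "norm (G x) \<le> S" for x
    unfolding S_def by (rule cSUP_upper) (use bdd in \<open>auto intro!: bdd_aboveI2\<close>)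
  let ?I = "\<integral>u. vallee_modulus (\<delta> * u) \<partial>\<nu>" and ?c = "\<integral>u. cis (- z * u) \<partial>\<nu>"
  have "norm (G x) * norm ?c \<le> S * ?I" for x
  proof -
    have i1: "integrable \<nu> (\<lambda>u. cis (- z * u) * G (x - u))"
      by (rule integrable_const_bound[where B=S]) (use GS in \<open>auto simp: norm_mult\<close>)
    have i2: "integrable \<nu> (\<lambda>u. cis (- z * u) * G x)"
      by (rule integrable_const_bound[where B=S]) (use GS in \<open>auto simp: norm_mult\<close>)
    have "norm (?c * G x) = norm (\<integral>u. cis (- z * u) * G (x - u) - cis (- z * u) * G x \<partial>\<nu>)"
      using i1 i2 G0[of x] by simp
    also have "\<dots> \<le> (\<integral>u. S * vallee_modulus (\<delta> * u) \<partial>\<nu>)"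
    proof (rule Bochner_Integration.integral_norm_bound_integral)
      show "integrable \<nu> (\<lambda>u. S * vallee_modulus (\<delta> * u))"
        by (intro integrable_mult_right integrable_const_bound[where B="2 * (\<integral>s. \<bar>vallee s\<bar> \<partial>lborel)"])
           (use vallee_modulus_le vallee_modulus_nonneg in auto)
      show "norm (cis (- z * u) * G (x - u) - cis (- z * u) * G x) \<le> S * vallee_modulus (\<delta> * u)" for u
      proof -
        have "norm (G (x - u) - G x) \<le> S * vallee_modulus (\<delta> * u)"
          unfolding G_def
          by (rule fejer_mean_bernstein[OF \<delta>, of "\<lambda>x. cis (- z * x) * D x" B])
             (use D GS[unfolded G_def] in \<open>auto simp: norm_mult\<close>)
        then show ?thesis
          by (simp add: norm_mult flip: right_diff_distrib)
      qed
    qed (use i1 i2 in auto)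
    finally show ?thesis
      by (simp add: norm_mult mult.commute)
  qed
  moreover have c: "0 < norm ?c"
    using small Bochner_Integration.integral_nonneg[of \<nu> "\<lambda>u. vallee_modulus (\<delta> * u)"] vallee_modulus_nonneg
    by (smt (verit))
  ultimately have "norm (G x) \<le> S * ?I / norm ?c" for x
    by (simp add: field_simps)
  then have "S \<le> S * ?I / norm ?c"
    unfolding S_def by (intro cSUP_least) auto
  then have "S * (norm ?c - ?I) \<le> 0"
    using c by (simp add: field_simps)
  then have "S \<le> 0"
    using small by (simp add: mult_le_0_iff)
  then have "G x = 0"
    using GS[of x] by (metis norm_ge_zero norm_le_zero_iff order_trans)
  then show ?thesis
    using EG[of x] by (simp add: E_def)
qed

text \<open>\<open>v\<^sup>2 * fejer v\<close> is the squared modulus of \<open>1 - cis v\<close>;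
  multiplied by the squared modulus of the geometric sum \<open>P\<close> it becomes that of
  \<open>1 - cis (real N * v)\<close>. In this way a kernel of bandwidth N \<delta> is composed of
  kernels of bandwidth \<delta> modulated by multiples of \<delta>.\<close>

lemma fejer_dilation_eq_sum:
  "(\<Sum>a<N. \<Sum>b<N. fejer v * cis ((real a - real b) * v)) = (real N)\<^sup>2 * fejer (real N * v)"
proof (cases "v = 0")
  case True
  then show ?thesis by (simp add: fejer_0 power2_eq_square)
next
  case False
  define P where "P = (\<Sum>a<N. cis v ^ a)"
  have [simp]: "cis v * cnj (cis v) = 1" "cis (real N * v) * cnj (cis (real N * v)) = 1" for v
    by (simp_all add: complex_norm_square[symmetric])
  have m: "(1 - cis w) * cnj (1 - cis w) = of_real (w\<^sup>2 * fejer w)" for w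
    unfolding fejer_mult by (simp add: complex_eq_iff algebra_simps cis.ctr flip: power2_eq_square)
  have "cis v ^ a * cnj (cis v ^ b) = cis ((real a - real b) * v)" for a b
    by (simp add: Complex.DeMoivre cis_cnj cis_mult left_diff_distrib)
  then have "(\<Sum>a<N. \<Sum>b<N. cis ((real a - real b) * v)) = P * cnj P"
    unfolding P_def cnj_sum sum_product
    by simp
  moreover have "(1 - cis v) * P = 1 - cis (real N * v)"
    unfolding P_def by (simp add: one_diff_power_eq flip: Complex.DeMoivre)
  then have "((1 - cis v) * cnj (1 - cis v)) * (P * cnj P) = (1 - cis (real N * v)) * cnj (1 - cis (real N * v))"
    by (metis (no_types, lifting) complex_cnj_mult mult.assoc mult.commute)
  then have "of_real (v\<^sup>2) * (of_real (fejer v) * (P * cnj P)) = of_real (v\<^sup>2) * of_real ((real N)\<^sup>2 * fejer (real N * v))"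
    unfolding m by (simp add: power_mult_distrib mult_ac)
  ultimately show ?thesis
    using False by (simp flip: sum_distrib_left)
qed

text \<open>All Fejer means of \<open>D\<close> vanish, and they recover the value of
  \<open>D\<close> wherever it is continuous. The transform of \<open>\<nu>\<close> has to be
  nonzero at every frequency because the bandwidth of these means is arbitrarily large.\<close>

theorem wiener_tauberian:
  fixes D :: "real \<Rightarrow> complex"
  assumes "finite_measure \<nu>" and sets: "sets \<nu> = sets borel"
    and nz: "\<And>z. (\<integral>u. cis (z * u) \<partial>\<nu>) \<noteq> 0"
    and [measurable]: "D \<in> borel_measurable borel" and D: "\<And>x. norm (D x) \<le> B"
    and N: "countable N" "\<And>y. y \<notin> N \<Longrightarrow> (\<integral>u. D (y - u) \<partial>\<nu>) = 0"
    and cont: "isCont D x"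
  shows "D x = 0"
proof -
  interpret finite_measure \<nu> by fact
  note [measurable_cong] = sets
  have mean0: "(\<integral>w. fejer (r * w) * D (x - w) \<partial>lborel) = 0" if r: "0 < r" for r
  proof -
    have cont: "continuous_on {- r..r} (\<lambda>z. norm (\<integral>u. cis (- z * u) \<partial>\<nu>))"
    proof (intro continuous_on_norm continuous_at_imp_continuous_on ballI)
      fix z
      show "isCont (\<lambda>z. \<integral>u. cis (- z * u) \<partial>\<nu>) z"
        unfolding continuous_at_sequentially
      proof safe
        fix X :: "nat \<Rightarrow> real" assume X: "X \<longlonglongrightarrow> z"
        have "(\<lambda>n. cis (- X n * u)) \<longlonglongrightarrow> cis (- z * u)" for u
          by (intro tendsto_intros X)
        then show "((\<lambda>z. \<integral>u. cis (- z * u) \<partial>\<nu>) \<circ> X) \<longlonglongrightarrow> (\<integral>u. cis (- z * u) \<partial>\<nu>)"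
          unfolding comp_def by (intro integral_dominated_convergence[where w="\<lambda>_. 1"]) auto
      qed
    qed
    \<comment> \<open>The modulus of the transform is continuous and attains its minimum over the
      compact band at \<open>z0\<close>; it is positive, so one bandwidth \<delta> is small enough
      for all frequencies in the band.\<close>
    obtain z0 where z0: "\<And>z. z \<in> {- r..r} \<Longrightarrow> norm (\<integral>u. cis (- z0 * u) \<partial>\<nu>) \<le> norm (\<integral>u. cis (- z * u) \<partial>\<nu>)"
      using continuous_attains_inf[OF compact_Icc _ cont] r by fastforce
    have "(\<lambda>n. \<integral>u. vallee_modulus (r / real (Suc n) * u) \<partial>\<nu>) \<longlonglongrightarrow> (\<integral>u. 0 \<partial>\<nu>)"
    proof (rule integral_dominated_convergence[where w="\<lambda>_. 2 * (\<integral>s. \<bar>vallee s\<bar> \<partial>lborel)"])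
      have "(\<lambda>n. r / real (Suc n) * u) \<longlonglongrightarrow> 0" for u
        by real_asymp
      then show "AE u in \<nu>. (\<lambda>n. vallee_modulus (r / real (Suc n) * u)) \<longlonglongrightarrow> 0"
        using vallee_modulus_tendsto_0 by auto
    qed (use vallee_modulus_le vallee_modulus_nonneg in auto)
    moreover have "0 < norm (\<integral>u. cis (- z0 * u) \<partial>\<nu>)"
      using nz[of "- z0"] by simp
    ultimately have "\<forall>\<^sub>F n in sequentially. (\<integral>u. vallee_modulus (r / real (Suc n) * u) \<partial>\<nu>) < norm (\<integral>u. cis (- z0 * u) \<partial>\<nu>)"
      by (intro order_tendstoD(2)) auto
    then obtain n where n: "(\<integral>u. vallee_modulus (r / real (Suc n) * u) \<partial>\<nu>) < norm (\<integral>u. cis (- z0 * u) \<partial>\<nu>)"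
      by (auto dest: eventually_happens)
    define M where "M = Suc n"
    define \<delta> where "\<delta> = r / real M"
    have \<delta>: "0 < \<delta>" "real M * \<delta> = r" and M: "0 < M" using r by (auto simp: \<delta>_def M_def)
    let ?g = "\<lambda>a b w. fejer (\<delta> * w) * cis ((real a - real b) * (\<delta> * w)) * D (x - w)"
    have g0: "(\<integral>w. ?g a b w \<partial>lborel) = 0" if "a < M" "b < M" for a b
    proof -
      \<comment> \<open>Since \<open>real M * \<delta> = r\<close>, all modulations needed for the
        wide kernel stay inside the band on which \<open>z0\<close> is minimal.\<close>
      have "\<bar>real a - real b\<bar> \<le> real M" using that by linarith
      then have "\<bar>(real a - real b) * \<delta>\<bar> \<le> r"
        using \<delta> by (metis abs_mult abs_of_pos mult_right_mono less_imp_le)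
      then have "(real a - real b) * \<delta> \<in> {- r..r}" by (auto simp: abs_le_iff)
      from fejer_mean_eq_0_of_small_band[OF assms(1,2,4) D N \<delta>(1), of "(real a - real b) * \<delta>" x]
        n z0[OF this] show ?thesis
        by (simp add: M_def[symmetric] \<delta>_def[symmetric] mult.assoc)
    qed
    have gi: "integrable lborel (?g a b)" for a b
    proof -
      have "integrable lborel (\<lambda>w. fejer (\<delta> * w) * (cis ((real a - real b) * \<delta> * w) * D (x - w)))"
        by (rule integrable_fejer_scale_mult[where B=B]) (use \<delta> D in \<open>auto simp: norm_mult\<close>)
      then show ?thesis by (simp add: mult.assoc)
    qed
    have "0 = (\<Sum>a<M. \<Sum>b<M. (\<integral>w. ?g a b w \<partial>lborel))"
      using g0 by simp
    also have "\<dots> = (\<integral>w. (\<Sum>a<M. \<Sum>b<M. ?g a b w) \<partial>lborel)"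
      using gi by (simp add: Bochner_Integration.integral_sum)
    also have "(\<lambda>w. \<Sum>a<M. \<Sum>b<M. ?g a b w) = (\<lambda>w. (real M)\<^sup>2 * (fejer (r * w) * D (x - w)))"
      using fejer_dilation_eq_sum[of "\<delta> * w" M for w] \<delta>(2)
      by (simp add: fun_eq_iff mult.assoc[symmetric] flip: sum_distrib_right)
    finally show ?thesis
      using M by simp
  qed
  \<comment> \<open>After substitution, growing bandwidth means a fixed kernel applied to values of
    \<open>D\<close> ever closer to \<open>x\<close>.\<close>
  have lim: "(\<lambda>n. \<integral>v. fejer v * D (x - v / real (Suc n)) \<partial>lborel) \<longlonglongrightarrow> (\<integral>v. fejer v * D x \<partial>lborel)"
  proof (rule integral_dominated_convergence[where w="\<lambda>v. fejer v * B"])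
    show "integrable lborel (\<lambda>v. fejer v * B)"
      using integrable_fejer by simp
    have "(\<lambda>n. fejer v * D (x - v / real (Suc n))) \<longlonglongrightarrow> fejer v * D x" for v
    proof (intro tendsto_intros isCont_tendsto_compose[OF cont])
      show "(\<lambda>n. x - v / real (Suc n)) \<longlonglongrightarrow> x" by real_asymp
    qed
    then show "AE v in lborel. (\<lambda>n. fejer v * D (x - v / real (Suc n))) \<longlonglongrightarrow> fejer v * D x" by simp
  qed (use D fejer_nonneg in \<open>auto simp: norm_mult intro!: mult_left_mono\<close>)
  have "(\<integral>v. fejer v * D (x - v / real (Suc n)) \<partial>lborel) = 0" for n
    using lborel_integral_real_affine[of "real (Suc n)" "\<lambda>v. fejer v * D (x - v / real (Suc n))" 0]
      mean0[of "real (Suc n)"] by simp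
  with lim have "(\<integral>v. fejer v * D x \<partial>lborel) = 0"
    by (simp only: LIMSEQ_const_iff)
  moreover have "(\<integral>v. fejer v * D x \<partial>lborel) = 2 * pi * D x"
    by (simp add: has_bochner_integral_integral_eq[OF has_bochner_integral_fejer])
  ultimately have "2 * pi * D x = 0"
    by argo
  then show ?thesis by simp
qed

section \<open>Convolutions of distributions and their tails\<close>

lemma real_distrD:
  assumes "real_distr \<rho>"
  shows "prob_space \<rho>" "finite_measure \<rho>" "sigma_finite_measure \<rho>" "sets \<rho> = sets borel" "space \<rho> = UNIV"
  using assms sets_eq_imp_space_eq[of \<rho> borel]
  by (auto simp: real_distr_def prob_space.finite_measure prob_space_imp_sigma_finite)

lemma real_distr_return: "real_distr (return borel a)"
  by (simp add: real_distr_def prob_space_return)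

lemma real_distr_convolution:
  assumes "real_distr \<alpha>" "real_distr \<beta>"
  shows "real_distr (convolution \<alpha> \<beta>)"
proof -
  interpret \<alpha>: prob_space \<alpha> using real_distrD[OF assms(1)] by simp
  interpret \<beta>: prob_space \<beta> using real_distrD[OF assms(2)] by simp
  interpret pair_prob_space \<alpha> \<beta> ..
  note [measurable_cong] = real_distrD(4)[OF assms(1)] real_distrD(4)[OF assms(2)]
  have "prob_space (distr (\<alpha> \<Otimes>\<^sub>M \<beta>) borel (\<lambda>(x, y). x + y))"
    by (rule prob_space_distr) measurable
  then show ?thesis
    by (simp add: real_distr_def convolution_def)
qed

lemma real_distr_conv_pow: "real_distr \<mu> \<Longrightarrow> real_distr (conv_pow \<mu> n)"
  by (induction n) (auto simp: real_distr_return real_distr_convolution)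

lemma convolution_return:
  assumes "real_distr \<mu>"
  shows "convolution \<mu> (return borel 0) = \<mu>"
proof (rule measure_eqI)
  note \<mu> = real_distrD[OF assms]
  note [measurable_cong] = \<mu>(4)
  fix A assume "A \<in> sets (convolution \<mu> (return borel 0))"
  then have [measurable]: "A \<in> sets borel" by simp
  have "emeasure (convolution \<mu> (return borel 0)) A = (\<integral>\<^sup>+x. indicator A x \<partial>convolution \<mu> (return borel 0))"
    by (rule nn_integral_indicator[symmetric]) simp
  also have "\<dots> = (\<integral>\<^sup>+x. \<integral>\<^sup>+y. indicator A (x + y) \<partial>return borel 0 \<partial>\<mu>)"
    by (rule nn_integral_convolution)
       (use \<mu> in \<open>auto simp: prob_space_return prob_space.finite_measure\<close>)
  also have "\<dots> = (\<integral>\<^sup>+x. indicator A x \<partial>\<mu>)"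
    by (subst nn_integral_return) auto
  finally show "emeasure (convolution \<mu> (return borel 0)) A = emeasure \<mu> A"
    by simp
qed (use real_distrD[OF assms] in simp)

lemma conv_pow_2: "real_distr \<mu> \<Longrightarrow> conv_pow \<mu> 2 = convolution \<mu> \<mu>"
  by (simp add: numeral_2_eq_2 convolution_return)

lemma convolution_real_distr_commute:
  "real_distr \<alpha> \<Longrightarrow> real_distr \<beta> \<Longrightarrow> convolution \<alpha> \<beta> = convolution \<beta> \<alpha>"
  by (rule convolution_commutative) (auto simp: real_distrD)

lemma integral_convolution:
  fixes f :: "real \<Rightarrow> 'a::{banach, second_countable_topology}"
  assumes \<alpha>: "real_distr \<alpha>" and \<beta>: "real_distr \<beta>" and f: "integrable (convolution \<alpha> \<beta>) f"
  shows "(\<integral>x. f x \<partial>convolution \<alpha> \<beta>) = (\<integral>u. \<integral>w. f (u + w) \<partial>\<beta> \<partial>\<alpha>)"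
proof -
  interpret \<alpha>: prob_space \<alpha> using real_distrD[OF \<alpha>] by simp
  interpret \<beta>: prob_space \<beta> using real_distrD[OF \<beta>] by simp
  interpret pair_prob_space \<alpha> \<beta> ..
  note [measurable_cong] = real_distrD(4)[OF \<alpha>] real_distrD(4)[OF \<beta>]
  have [measurable]: "f \<in> borel_measurable borel"
    using borel_measurable_integrable[OF f] by simp
  have "integrable (\<alpha> \<Otimes>\<^sub>M \<beta>) (\<lambda>(u, w). f (u + w))"
    using f unfolding convolution_def by (subst (asm) integrable_distr_eq) (auto simp: case_prod_unfold)
  from integral_fst[OF this] show ?thesis
    by (simp add: convolution_def integral_distr case_prod_unfold)
qed

section \<open>Exponential moments and transforms of convolutions\<close>

lemma borel_measurable_exp_real_distr:
  "real_distr \<rho> \<Longrightarrow> (\<lambda>x. exp (\<gamma> * x)) \<in> borel_measurable \<rho>"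
  by (subst measurable_cong_sets[OF real_distrD(4) refl]) auto

lemma mgf_finite_iff_integrable:
  "real_distr \<rho> \<Longrightarrow> mgf_finite \<rho> \<gamma> \<longleftrightarrow> integrable \<rho> (\<lambda>x. exp (\<gamma> * x))"
  by (auto simp: mgf_finite_def integrable_iff_bounded borel_measurable_exp_real_distr)

lemma mgf_finite_convolution:
  assumes \<alpha>: "real_distr \<alpha>" "mgf_finite \<alpha> \<gamma>" and \<beta>: "real_distr \<beta>" "mgf_finite \<beta> \<gamma>"
  shows "mgf_finite (convolution \<alpha> \<beta>) \<gamma>"
proof -
  note [measurable_cong] = real_distrD(4)[OF \<alpha>(1)] real_distrD(4)[OF \<beta>(1)]
  have "(\<integral>\<^sup>+x. ennreal (exp (\<gamma> * x)) \<partial>convolution \<alpha> \<beta>) =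
      (\<integral>\<^sup>+u. \<integral>\<^sup>+w. ennreal (exp (\<gamma> * u)) * ennreal (exp (\<gamma> * w)) \<partial>\<beta> \<partial>\<alpha>)"
    by (subst nn_integral_convolution)
       (use \<alpha> \<beta> in \<open>auto simp: real_distrD distrib_left exp_add ennreal_mult\<close>)
  also have "\<dots> = (\<integral>\<^sup>+u. ennreal (exp (\<gamma> * u)) \<partial>\<alpha>) * (\<integral>\<^sup>+w. ennreal (exp (\<gamma> * w)) \<partial>\<beta>)"
    by (simp add: nn_integral_cmult nn_integral_multc)
  also have "\<dots> < \<infinity>"
    using \<alpha>(2) \<beta>(2) by (auto simp: mgf_finite_def ennreal_mult_less_top)
  finally show ?thesis by (simp add: mgf_finite_def)
qed

lemma mgf_finite_return: "mgf_finite (return borel 0) \<gamma>"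
  by (simp add: mgf_finite_def nn_integral_return)

lemma mgf_finite_conv_pow: "real_distr \<mu> \<Longrightarrow> mgf_finite \<mu> \<gamma> \<Longrightarrow> mgf_finite (conv_pow \<mu> n) \<gamma>"
  by (induction n) (auto simp: mgf_finite_return mgf_finite_convolution real_distr_conv_pow)

lemma mgf_complex_eq:
  "mgf_complex \<rho> \<gamma> z = (\<integral>x. exp (\<gamma> * x) * cis (z * x) \<partial>\<rho>)"
  unfolding mgf_complex_def
  by (intro Bochner_Integration.integral_cong) (auto simp: distrib_right exp_add cis_conv_exp mult.assoc simp flip: exp_of_real)

lemma integrable_exp_cis:
  assumes \<rho>: "real_distr \<rho>" "mgf_finite \<rho> \<gamma>"
  shows "integrable \<rho> (\<lambda>x. complex_of_real (exp (\<gamma> * x)) * cis (z * x))"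
proof -
  note [measurable_cong] = real_distrD(4)[OF \<rho>(1)]
  from \<rho> have "integrable \<rho> (\<lambda>x. complex_of_real (exp (\<gamma> * x)))"
    by (subst complex_of_real_integrable_eq) (simp add: mgf_finite_iff_integrable)
  then show ?thesis
    by (rule Bochner_Integration.integrable_bound) (auto simp: norm_mult)
qed

lemma mgf_complex_convolution:
  assumes \<alpha>: "real_distr \<alpha>" "mgf_finite \<alpha> \<gamma>" and \<beta>: "real_distr \<beta>" "mgf_finite \<beta> \<gamma>"
  shows "mgf_complex (convolution \<alpha> \<beta>) \<gamma> z = mgf_complex \<alpha> \<gamma> z * mgf_complex \<beta> \<gamma> z"
proof -
  have "mgf_complex (convolution \<alpha> \<beta>) \<gamma> z =
      (\<integral>u. \<integral>w. (exp (\<gamma> * u) * cis (z * u)) * (exp (\<gamma> * w) * cis (z * w)) \<partial>\<beta> \<partial>\<alpha>)"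
    unfolding mgf_complex_eq
    by (subst integral_convolution[OF \<alpha>(1) \<beta>(1) integrable_exp_cis])
       (auto intro!: real_distr_convolution mgf_finite_convolution \<alpha> \<beta> Bochner_Integration.integral_cong
          simp: distrib_left exp_add mult_ac simp flip: cis_mult)
  then show ?thesis by (simp add: mgf_complex_eq)
qed

text \<open>This carries the absence of zeros from \<mu> over to the power that will serve as the
  annihilating measure.\<close>

lemma mgf_complex_conv_pow:
  assumes "real_distr \<mu>" "mgf_finite \<mu> \<gamma>"
  shows "mgf_complex (conv_pow \<mu> n) \<gamma> z = mgf_complex \<mu> \<gamma> z ^ n"
proof (induction n)
  case 0
  have "(\<lambda>x. complex_of_real (exp (\<gamma> * x)) * cis (z * x)) \<in> borel_measurable borel"
    by (intro borel_measurable_continuous_onI continuous_intros)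
  then show ?case
    by (simp add: mgf_complex_eq integral_return)
next
  case (Suc n)
  then show ?case
    by (simp add: mgf_complex_convolution assms real_distr_conv_pow mgf_finite_conv_pow)
qed

lemma mgf_pos:
  assumes "real_distr \<rho>" "mgf_finite \<rho> \<gamma>"
  shows "0 < mgf \<rho> \<gamma>"
proof -
  interpret prob_space \<rho> using real_distrD[OF assms(1)] by simp
  have "integrable \<rho> (\<lambda>x. exp (\<gamma> * x))" using assms by (simp add: mgf_finite_iff_integrable)
  from integral_less_AE_space[OF integrable_zero this] show ?thesis
    by (simp add: mgf_def emeasure_space_1)
qed

section \<open>Tails, and the splitting of the tail of a convolution\<close>

lemma tail_nonneg: "0 \<le> tail \<rho> x"
  by (simp add: tail_def)

lemma tail_antimono:
  assumes "real_distr \<rho>" "x \<le> y"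
  shows "tail \<rho> y \<le> tail \<rho> x"
proof -
  interpret prob_space \<rho> using real_distrD[OF assms(1)] by simp
  show ?thesis unfolding tail_def
    by (rule finite_measure_mono) (use assms in \<open>auto simp: real_distrD\<close>)
qed

lemma tail_le_1: "real_distr \<rho> \<Longrightarrow> tail \<rho> x \<le> 1"
  unfolding tail_def by (rule prob_space.prob_le_1) (rule real_distrD)

lemma borel_measurable_tail:
  assumes "real_distr \<rho>"
  shows "tail \<rho> \<in> borel_measurable borel"
proof -
  have "(\<lambda>x. - tail \<rho> x) \<in> borel_measurable borel"
    by (rule borel_measurable_mono) (auto simp: mono_def tail_antimono[OF assms])
  then have "(\<lambda>x. - (- tail \<rho> x)) \<in> borel_measurable borel"
    by measurable
  then show ?thesis by simp
qed

lemma continuous_at_right_tail: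
  assumes "real_distr \<rho>"
  shows "continuous (at_right x) (tail \<rho>)"
proof -
  interpret real_distribution \<rho>
    using real_distrD[OF assms] by (auto simp: real_distribution_def real_distribution_axioms_def)
  have "tail \<rho> = (\<lambda>x. 1 - cdf \<rho> x)"
  proof
    fix x
    have "{x<..} = space \<rho> - {..x}" by auto
    then show "tail \<rho> x = 1 - cdf \<rho> x"
      unfolding tail_def cdf_def using prob_compl[of "{..x}"] by simp
  qed
  then show ?thesis
    using cdf_is_right_cont[of x] by (simp add: continuous_diff)
qed

lemma
  assumes \<alpha>: "real_distr \<alpha>" and \<beta>: "real_distr \<beta>" and Q: "Q \<in> sets (borel \<Otimes>\<^sub>M borel)"
  shows measure_pair_real_distr: "measure (\<alpha> \<Otimes>\<^sub>M \<beta>) Q = (\<integral>u. measure \<beta> {w. (u, w) \<in> Q} \<partial>\<alpha>)"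
    and measure_pair_real_distr': "measure (\<alpha> \<Otimes>\<^sub>M \<beta>) Q = (\<integral>w. measure \<alpha> {u. (u, w) \<in> Q} \<partial>\<beta>)"
proof -
  interpret \<alpha>: prob_space \<alpha> using real_distrD[OF \<alpha>] by simp
  interpret \<beta>: prob_space \<beta> using real_distrD[OF \<beta>] by simp
  interpret pair_prob_space \<alpha> \<beta> ..
  note [measurable_cong] = real_distrD(4)[OF \<alpha>] real_distrD(4)[OF \<beta>]
  note [measurable] = Q
  have "integrable (\<alpha> \<Otimes>\<^sub>M \<beta>) (indicator Q :: _ \<Rightarrow> real)"
    by (rule integrable_const_bound[where B=1]) auto
  then have i: "integrable (\<alpha> \<Otimes>\<^sub>M \<beta>) (case_prod (\<lambda>u w. indicator Q (u, w) :: real))"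
    by simp
  have 1: "(\<integral>w. indicator Q (u, w) \<partial>\<beta>) = measure \<beta> {w. (u, w) \<in> Q}" for u
  proof -
    have "(\<lambda>w. indicator Q (u, w) :: real) = indicator {w. (u, w) \<in> Q}" by (auto simp: indicator_def)
    then show ?thesis using \<beta> by (simp add: real_distrD)
  qed
  have 2: "(\<integral>u. indicator Q (u, w) \<partial>\<alpha>) = measure \<alpha> {u. (u, w) \<in> Q}" for w
  proof -
    have "(\<lambda>u. indicator Q (u, w) :: real) = indicator {u. (u, w) \<in> Q}" by (auto simp: indicator_def)
    then show ?thesis using \<alpha> by (simp add: real_distrD)
  qed
  have "space (\<alpha> \<Otimes>\<^sub>M \<beta>) = UNIV" using \<alpha> \<beta> by (simp add: space_pair_measure real_distrD)
  then have 3: "measure (\<alpha> \<Otimes>\<^sub>M \<beta>) Q = (\<integral>p. indicator Q p \<partial>(\<alpha> \<Otimes>\<^sub>M \<beta>))" by simp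
  show "measure (\<alpha> \<Otimes>\<^sub>M \<beta>) Q = (\<integral>u. measure \<beta> {w. (u, w) \<in> Q} \<partial>\<alpha>)"
    using integral_fst[OF i] unfolding 1 3 by simp
  show "measure (\<alpha> \<Otimes>\<^sub>M \<beta>) Q = (\<integral>w. measure \<alpha> {u. (u, w) \<in> Q} \<partial>\<beta>)"
    using integral_snd[OF i] unfolding 2 3 by simp
qed

lemma sets_Collect_pair:
  assumes "Measurable.pred (borel \<Otimes>\<^sub>M borel) (\<lambda>(u::real, w::real). P u w)"
  shows "{(u, w). P u w} \<in> sets (borel \<Otimes>\<^sub>M borel)"
  using assms by (simp add: pred_def space_pair_measure case_prod_unfold)

text \<open>The contribution of two summands that both exceed \<open>A\<close>, which the
  one-big-jump principle declares negligible.\<close>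

definition joint_tail :: "real measure \<Rightarrow> real measure \<Rightarrow> real \<Rightarrow> real \<Rightarrow> real" where
  "joint_tail \<alpha> \<beta> A x = measure (\<alpha> \<Otimes>\<^sub>M \<beta>) {(u, w). A < u \<and> A < w \<and> x < u + w}"

lemma joint_tail_nonneg: "0 \<le> joint_tail \<alpha> \<beta> A x"
  by (simp add: joint_tail_def)

lemma
  assumes \<alpha>: "real_distr \<alpha>" and \<beta>: "real_distr \<beta>"
  shows joint_tail_eq: "joint_tail \<alpha> \<beta> A x = (\<integral>u. indicator {A<..} u * tail \<beta> (max A (x - u)) \<partial>\<alpha>)"
    and joint_tail_eq': "joint_tail \<alpha> \<beta> A x = (\<integral>w. indicator {A<..} w * tail \<alpha> (max A (x - w)) \<partial>\<beta>)"
proof -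
  have Q: "{(u, w). A < u \<and> A < w \<and> x < u + w} \<in> sets (borel \<Otimes>\<^sub>M borel)"
    by (rule sets_Collect_pair) measurable
  have 1: "measure \<beta> {w. (u, w) \<in> {(u, w). A < u \<and> A < w \<and> x < u + w}} = indicator {A<..} u * tail \<beta> (max A (x - u))" for u
    by (auto simp: tail_def indicator_def intro!: arg_cong[where f="measure \<beta>"])
  have 2: "measure \<alpha> {u. (u, w) \<in> {(u, w). A < u \<and> A < w \<and> x < u + w}} = indicator {A<..} w * tail \<alpha> (max A (x - w))" for w
    by (auto simp: tail_def indicator_def intro!: arg_cong[where f="measure \<alpha>"])
  show "joint_tail \<alpha> \<beta> A x = (\<integral>u. indicator {A<..} u * tail \<beta> (max A (x - u)) \<partial>\<alpha>)"
    unfolding joint_tail_def measure_pair_real_distr[OF \<alpha> \<beta> Q] 1 ..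
  show "joint_tail \<alpha> \<beta> A x = (\<integral>w. indicator {A<..} w * tail \<alpha> (max A (x - w)) \<partial>\<beta>)"
    unfolding joint_tail_def measure_pair_real_distr'[OF \<alpha> \<beta> Q] 2 ..
qed

lemma integrable_tail_mult:
  assumes \<alpha>: "real_distr \<alpha>" and \<beta>: "real_distr \<beta>" and [measurable]: "g \<in> borel_measurable borel" "S \<in> sets borel"
  shows "integrable \<alpha> (\<lambda>u. indicator S u * tail \<beta> (g u))"
proof -
  interpret prob_space \<alpha> using real_distrD[OF \<alpha>] by simp
  note [measurable_cong] = real_distrD(4)[OF \<alpha>] and [measurable] = borel_measurable_tail[OF \<beta>]
  show ?thesis
    by (rule integrable_const_bound[where B=1])
       (use tail_le_1[OF \<beta>] in \<open>auto simp: tail_nonneg indicator_def\<close>)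
qed

text \<open>The two disintegrations show the tail of one factor each. Thus \<open>\<beta>\<close> is
  replaced by \<open>\<rho>\<close> under the integral over \<open>\<alpha>\<close>, and then
  \<open>\<alpha>\<close> by \<open>\<rho>\<close> under the integral over \<open>\<rho>\<close>,
  using only comparisons of tails.\<close>

lemma joint_tail_le:
  assumes \<alpha>: "real_distr \<alpha>" and \<beta>: "real_distr \<beta>" and \<rho>: "real_distr \<rho>"
    and C: "\<And>x. tail \<alpha> x \<le> C * tail \<rho> x" and C': "\<And>x. tail \<beta> x \<le> C' * tail \<rho> x" and "0 \<le> C'"
  shows "joint_tail \<alpha> \<beta> A x \<le> C' * C * joint_tail \<rho> \<rho> A x"
proof -
  have "joint_tail \<alpha> \<beta> A x \<le> (\<integral>u. C' * (indicator {A<..} u * tail \<rho> (max A (x - u))) \<partial>\<alpha>)"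
    unfolding joint_tail_eq[OF \<alpha> \<beta>]
    by (intro integral_mono integrable_mult_right integrable_tail_mult \<alpha> \<beta> \<rho>)
       (use C' in \<open>auto simp: indicator_def\<close>)
  also have "\<dots> = C' * joint_tail \<alpha> \<rho> A x"
    unfolding joint_tail_eq[OF \<alpha> \<rho>] by simp
  also have "joint_tail \<alpha> \<rho> A x \<le> (\<integral>u. C * (indicator {A<..} u * tail \<rho> (max A (x - u))) \<partial>\<rho>)"
    unfolding joint_tail_eq'[OF \<alpha> \<rho>]
    by (intro integral_mono integrable_mult_right integrable_tail_mult \<alpha> \<beta> \<rho>)
       (use C in \<open>auto simp: indicator_def\<close>)
  also have "\<dots> = C * joint_tail \<rho> \<rho> A x"
    unfolding joint_tail_eq'[OF \<rho> \<rho>] by simp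
  finally show ?thesis
    using \<open>0 \<le> C'\<close> by (simp add: mult_left_mono mult.assoc)
qed

lemma joint_tail_antimono:
  assumes \<alpha>: "real_distr \<alpha>" and \<beta>: "real_distr \<beta>" and "A \<le> A'"
  shows "joint_tail \<alpha> \<beta> A' x \<le> joint_tail \<alpha> \<beta> A x"
proof -
  interpret \<alpha>: prob_space \<alpha> using real_distrD[OF \<alpha>] by simp
  interpret \<beta>: prob_space \<beta> using real_distrD[OF \<beta>] by simp
  interpret pair_prob_space \<alpha> \<beta> ..
  note [measurable_cong] = real_distrD(4)[OF \<alpha>] real_distrD(4)[OF \<beta>]
  have sp: "space \<alpha> = UNIV" "space \<beta> = UNIV" using \<alpha> \<beta> by (auto simp: real_distrD)
  have "{(u, w). A < u \<and> A < w \<and> x < u + w} \<in> sets (borel \<Otimes>\<^sub>M borel)"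
    by (rule sets_Collect_pair) measurable
  also have "sets (borel \<Otimes>\<^sub>M borel) = sets (\<alpha> \<Otimes>\<^sub>M \<beta>)"
    by (rule sets_pair_measure_cong) (simp_all add: real_distrD \<alpha> \<beta>)
  finally show ?thesis
    unfolding joint_tail_def by (intro finite_measure_mono) (use assms in auto)
qed

text \<open>In the second equation \<open>2 * A \<le> x\<close> makes the events disjoint: two
  summands that are both at most \<open>A\<close> cannot have a sum above \<open>x\<close>.\<close>

lemma tail_convolution:
  assumes \<alpha>: "real_distr \<alpha>" and \<beta>: "real_distr \<beta>"
  shows "tail (convolution \<alpha> \<beta>) x = (\<integral>s. tail \<alpha> (x - s) \<partial>\<beta>)"
    and "2 * A \<le> x \<Longrightarrow> tail (convolution \<alpha> \<beta>) x = (\<integral>s. indicator {..A} s * tail \<alpha> (x - s) \<partial>\<beta>) +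
      (\<integral>u. indicator {..A} u * tail \<beta> (x - u) \<partial>\<alpha>) + joint_tail \<alpha> \<beta> A x"
proof -
  interpret \<alpha>: prob_space \<alpha> using real_distrD[OF \<alpha>] by simp
  interpret \<beta>: prob_space \<beta> using real_distrD[OF \<beta>] by simp
  interpret pair_prob_space \<alpha> \<beta> ..
  note [measurable_cong] = real_distrD(4)[OF \<alpha>] real_distrD(4)[OF \<beta>]
  have sets_eq: "sets (borel \<Otimes>\<^sub>M borel) = sets (\<alpha> \<Otimes>\<^sub>M \<beta>)"
    by (rule sets_pair_measure_cong) (simp_all add: real_distrD \<alpha> \<beta>)
  have sp: "space (\<alpha> \<Otimes>\<^sub>M \<beta>) = UNIV"
    using \<alpha> \<beta> by (simp add: space_pair_measure real_distrD)
  let ?S = "{(u, w). x < u + w}" and ?J = "{(u, w). A < u \<and> A < w \<and> x < u + w}"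
  let ?P = "{(u, w). w \<le> A \<and> x < u + w}" and ?Q = "{(u, w). u \<le> A \<and> x < u + w}"
  have m: "?S \<in> sets (borel \<Otimes>\<^sub>M borel)" "?P \<in> sets (borel \<Otimes>\<^sub>M borel)" "?Q \<in> sets (borel \<Otimes>\<^sub>M borel)" "?J \<in> sets (borel \<Otimes>\<^sub>M borel)"
    by (rule sets_Collect_pair, measurable)+
  note m' = m[unfolded sets_eq]
  have S: "tail (convolution \<alpha> \<beta>) x = measure (\<alpha> \<Otimes>\<^sub>M \<beta>) ?S"
    unfolding tail_def convolution_def
    by (subst measure_distr) (auto simp: sp case_prod_unfold intro!: arg_cong[where f="measure (\<alpha> \<Otimes>\<^sub>M \<beta>)"])
  show "tail (convolution \<alpha> \<beta>) x = (\<integral>s. tail \<alpha> (x - s) \<partial>\<beta>)"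
    unfolding S measure_pair_real_distr'[OF \<alpha> \<beta> m(1)]
    by (auto intro!: Bochner_Integration.integral_cong arg_cong[where f="measure \<alpha>"] simp: tail_def)
  assume x: "2 * A \<le> x"
  have "?S = (?P \<union> ?Q) \<union> ?J" by auto
  then have "measure (\<alpha> \<Otimes>\<^sub>M \<beta>) ?S = measure (\<alpha> \<Otimes>\<^sub>M \<beta>) ((?P \<union> ?Q) \<union> ?J)" by simp
  also have "\<dots> = measure (\<alpha> \<Otimes>\<^sub>M \<beta>) (?P \<union> ?Q) + measure (\<alpha> \<Otimes>\<^sub>M \<beta>) ?J"
    by (rule finite_measure_Union) (use m' in auto)
  also have "measure (\<alpha> \<Otimes>\<^sub>M \<beta>) (?P \<union> ?Q) = measure (\<alpha> \<Otimes>\<^sub>M \<beta>) ?P + measure (\<alpha> \<Otimes>\<^sub>M \<beta>) ?Q"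
    by (rule finite_measure_Union) (use m' x in auto)
  also have "measure (\<alpha> \<Otimes>\<^sub>M \<beta>) ?P = (\<integral>s. indicator {..A} s * tail \<alpha> (x - s) \<partial>\<beta>)"
    unfolding measure_pair_real_distr'[OF \<alpha> \<beta> m(2)]
    by (auto intro!: Bochner_Integration.integral_cong arg_cong[where f="measure \<alpha>"] simp: tail_def indicator_def)
  also have "measure (\<alpha> \<Otimes>\<^sub>M \<beta>) ?Q = (\<integral>u. indicator {..A} u * tail \<beta> (x - u) \<partial>\<alpha>)"
    unfolding measure_pair_real_distr[OF \<alpha> \<beta> m(3)]
    by (auto intro!: Bochner_Integration.integral_cong arg_cong[where f="measure \<beta>"] simp: tail_def indicator_def)
  finally show "tail (convolution \<alpha> \<beta>) x = (\<integral>s. indicator {..A} s * tail \<alpha> (x - s) \<partial>\<beta>) +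
      (\<integral>u. indicator {..A} u * tail \<beta> (x - u) \<partial>\<alpha>) + joint_tail \<alpha> \<beta> A x"
    unfolding S joint_tail_def .
qed

section \<open>Convolution equivalence and the one-big-jump principle\<close>

text \<open>Interchange of two limits. The approximant \<open>g\<close> may vary with
  \<open>e\<close>; it will be a truncation at a level chosen for \<open>e\<close>.\<close>

lemma tendsto_of_approx:
  fixes f :: "'a \<Rightarrow> real"
  assumes "\<And>e. 0 < e \<Longrightarrow> \<exists>g l. (g \<longlongrightarrow> l) F \<and> \<bar>l - L\<bar> \<le> e \<and> (\<forall>\<^sub>F x in F. \<bar>f x - g x\<bar> \<le> e)"
  shows "(f \<longlongrightarrow> L) F"
proof (rule tendstoI)
  fix e :: real assume "0 < e"
  then obtain g l where g: "(g \<longlongrightarrow> l) F" "\<bar>l - L\<bar> \<le> e / 4" "\<forall>\<^sub>F x in F. \<bar>f x - g x\<bar> \<le> e / 4"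
    using assms[of "e / 4"] by auto
  from tendstoD[OF g(1), of "e / 4"] \<open>0 < e\<close> have "\<forall>\<^sub>F x in F. dist (g x) l < e / 4" by simp
  with g(3) show "\<forall>\<^sub>F x in F. dist (f x) L < e"
    by eventually_elim (use g(2) \<open>0 < e\<close> in \<open>simp add: dist_real_def abs_if split: if_splits\<close>)
qed

lemma class_L_tendsto_quotient:
  assumes "class_L \<gamma> \<rho>"
  shows "((\<lambda>x. tail \<rho> (x + a) / tail \<rho> x) \<longlongrightarrow> exp (- \<gamma> * a)) at_top"
proof -
  have "((\<lambda>x. exp (- \<gamma> * a) * (tail \<rho> (x + a) / (exp (- \<gamma> * a) * tail \<rho> x))) \<longlongrightarrow> exp (- \<gamma> * a) * 1) at_top"
    using assms by (intro tendsto_mult tendsto_const) (auto simp: class_L_def)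
  then show ?thesis by simp
qed

locale convolution_equivalent =
  fixes \<rho> :: "real measure" and \<gamma> :: real
  assumes distr: "real_distr \<rho>" and S: "class_S \<gamma> \<rho>"
begin

lemma R_pos: "0 < tail \<rho> x"
  using S by (auto simp: class_S_def class_L_def)

lemma R_quotient: "((\<lambda>x. tail \<rho> (x + a) / tail \<rho> x) \<longlongrightarrow> exp (- \<gamma> * a)) at_top"
  using S by (intro class_L_tendsto_quotient) (auto simp: class_S_def)

lemma mgf_finite_\<rho>: "mgf_finite \<rho> \<gamma>"
  using S by (simp add: class_S_def)

lemma tendsto_truncated_integral:
  assumes \<beta>: "real_distr \<beta>" and f: "integrable \<beta> f"
  shows "((\<lambda>A. \<integral>s. indicator {..A} s * f s \<partial>\<beta>) \<longlongrightarrow> (\<integral>s. f s \<partial>\<beta> :: real)) at_top"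
proof (rule integral_dominated_convergence_at_top)
  note [measurable_cong] = real_distrD(4)[OF \<beta>]
  have [measurable]: "f \<in> borel_measurable borel"
    using borel_measurable_integrable[OF f] by (simp add: measurable_cong_sets[OF real_distrD(4)[OF \<beta>] refl])
  show "integrable \<beta> (\<lambda>s. \<bar>f s\<bar>)" using f by simp
  show "f \<in> borel_measurable \<beta>" "(\<lambda>s. indicator {..A} s * f s) \<in> borel_measurable \<beta>" for A :: real
    by measurable
  show "\<forall>\<^sub>F A in at_top. AE s in \<beta>. norm (indicator {..A} s * f s) \<le> \<bar>f s\<bar>"
    by (auto simp: indicator_def)
  have "((\<lambda>A. indicator {..A} s * f s) \<longlongrightarrow> f s) at_top" for s
    by (rule tendsto_eventually, use eventually_ge_at_top[of s] in eventually_elim) auto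
  then show "AE s in \<beta>. ((\<lambda>A. indicator {..A} s * f s) \<longlongrightarrow> f s) at_top" by simp
qed

text \<open>Divided by the tail of \<rho>, the tail of its square tends to
  \<open>2 * mgf \<rho> \<gamma>\<close>. The two parts in which one summand is at most
  \<open>A\<close> together tend to \<open>2 * ?I A\<close>, which is nearly as large for suitable
  \<open>A\<close>, so little is left for the joint part.\<close>

lemma joint_tail_small:
  assumes "0 < e"
  shows "\<exists>A0. \<forall>A\<ge>A0. \<forall>\<^sub>F x in at_top. joint_tail \<rho> \<rho> A x \<le> e * tail \<rho> x"
proof -
  interpret prob_space \<rho> using real_distrD[OF distr] by simp
  note [measurable_cong] = real_distrD(4)[OF distr] and [measurable] = borel_measurable_tail[OF distr]
  let ?R = "tail \<rho>" and ?I = "\<lambda>A. \<integral>s. indicator {..A} s * exp (\<gamma> * s) \<partial>\<rho>"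
  have "(?I \<longlongrightarrow> mgf \<rho> \<gamma>) at_top"
    unfolding mgf_def using mgf_finite_\<rho>
    by (intro tendsto_truncated_integral distr) (simp add: mgf_finite_iff_integrable distr)
  from order_tendstoD(1)[OF this, of "mgf \<rho> \<gamma> - e / 2"] assms
  obtain A where A: "mgf \<rho> \<gamma> - e / 2 < ?I A"
    by (auto dest: eventually_happens)
  have "((\<lambda>x. \<integral>s. indicator {..A} s * ?R (x - s) / ?R x \<partial>\<rho>) \<longlongrightarrow> ?I A) at_top"
  proof (rule integral_dominated_convergence_at_top)
    show "integrable \<rho> (\<lambda>_. exp (\<gamma> * A) + 1)" by simp
    \<comment> \<open>For \<open>s \<le> A\<close> monotonicity bounds the quotient by its value at
      \<open>s = A\<close>, which converges to \<open>exp (\<gamma> * A)\<close>; the summand 1 is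
      slack.\<close>
    have "\<forall>\<^sub>F x in at_top. ?R (x + - A) / ?R x < exp (- \<gamma> * - A) + 1"
      by (rule order_tendstoD(2)[OF R_quotient]) simp
    then show "\<forall>\<^sub>F x in at_top. AE s in \<rho>. norm (indicator {..A} s * ?R (x - s) / ?R x) \<le> exp (\<gamma> * A) + 1"
    proof eventually_elim
      case (elim x)
      have "norm (indicator {..A} s * ?R (x - s) / ?R x) \<le> exp (\<gamma> * A) + 1" for s
      proof (cases "s \<le> A")
        case True
        then have "?R (x - s) / ?R x \<le> ?R (x + - A) / ?R x"
          using R_pos[of x] by (intro divide_right_mono tail_antimono distr) auto
        with elim True R_pos[of x] show ?thesis by (simp add: tail_nonneg)
      qed (simp add: add_nonneg_nonneg)
      then show ?case by simp
    qed
    have "((\<lambda>x. indicator {..A} s * ?R (x - s) / ?R x) \<longlongrightarrow> indicator {..A} s * exp (\<gamma> * s)) at_top" for s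
      using tendsto_mult_left[OF R_quotient[of "- s"], of "indicator {..A} s"] by simp
    then show "AE s in \<rho>. ((\<lambda>x. indicator {..A} s * ?R (x - s) / ?R x) \<longlongrightarrow> indicator {..A} s * exp (\<gamma> * s)) at_top"
      by simp
  qed measurable
  moreover have "((\<lambda>x. tail (convolution \<rho> \<rho>) x / ?R x) \<longlongrightarrow> 2 * mgf \<rho> \<gamma>) at_top"
  proof -
    have "((\<lambda>x. 2 * mgf \<rho> \<gamma> * (tail (conv_pow \<rho> 2) x / (2 * mgf \<rho> \<gamma> * ?R x))) \<longlongrightarrow> 2 * mgf \<rho> \<gamma> * 1) at_top"
      using S by (intro tendsto_mult tendsto_const) (auto simp: class_S_def)
    then show ?thesis
      using mgf_pos[OF distr mgf_finite_\<rho>] by (simp add: conv_pow_2 distr)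
  qed
  ultimately have "((\<lambda>x. tail (convolution \<rho> \<rho>) x / ?R x - 2 * (\<integral>s. indicator {..A} s * ?R (x - s) / ?R x \<partial>\<rho>)) \<longlongrightarrow> 2 * mgf \<rho> \<gamma> - 2 * ?I A) at_top"
    by (intro tendsto_intros)
  from order_tendstoD(2)[OF this, of e] A
  have "\<forall>\<^sub>F x in at_top. tail (convolution \<rho> \<rho>) x / ?R x - 2 * (\<integral>s. indicator {..A} s * ?R (x - s) / ?R x \<partial>\<rho>) < e"
    by simp
  moreover have "\<forall>\<^sub>F x in at_top. 2 * A \<le> x" by (rule eventually_ge_at_top)
  ultimately have "\<forall>\<^sub>F x in at_top. joint_tail \<rho> \<rho> A x \<le> e * ?R x"
  proof eventually_elim
    case (elim x)
    then show ?case
      using R_pos[of x] tail_convolution(2)[OF distr distr elim(2)] by (simp add: field_simps)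
  qed
  then have "\<forall>\<^sub>F x in at_top. joint_tail \<rho> \<rho> A' x \<le> e * ?R x" if "A \<le> A'" for A'
    by eventually_elim (use joint_tail_antimono[OF distr distr that] order_trans in blast)
  then show ?thesis by blast
qed

text \<open>A class that contains the point mass at 0, is closed under convolution, and still has
  negligible joint tails. The exponential moment provides the integrable majorants for limit
  profiles.\<close>

definition dominated :: "real measure \<Rightarrow> bool" where
  "dominated \<alpha> \<longleftrightarrow> real_distr \<alpha> \<and> mgf_finite \<alpha> \<gamma> \<and> (\<exists>C. \<forall>x. tail \<alpha> x \<le> C * tail \<rho> x)"

lemma dominatedD:
  assumes "dominated \<alpha>"
  shows "real_distr \<alpha>" "mgf_finite \<alpha> \<gamma>" "\<exists>C\<ge>0. \<forall>x. tail \<alpha> x \<le> C * tail \<rho> x"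
proof -
  show "real_distr \<alpha>" "mgf_finite \<alpha> \<gamma>" using assms by (auto simp: dominated_def)
  from assms obtain C where "\<forall>x. tail \<alpha> x \<le> C * tail \<rho> x" by (auto simp: dominated_def)
  then have "\<forall>x. tail \<alpha> x \<le> max 0 C * tail \<rho> x"
    using R_pos by (metis max.cobounded2 less_imp_le mult_right_mono order_trans)
  then show "\<exists>C\<ge>0. \<forall>x. tail \<alpha> x \<le> C * tail \<rho> x"
    by (intro exI[of _ "max 0 C"]) auto
qed

lemma dominated_return: "dominated (return borel 0)"
proof -
  have "tail (return borel 0) x \<le> 1 / tail \<rho> 0 * tail \<rho> x" for x
  proof (cases "x < 0")
    case True
    then show ?thesis
      using tail_antimono[OF distr, of x 0] R_pos[of 0] by (simp add: tail_def measure_return)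
  next
    case False
    then show ?thesis using R_pos by (simp add: tail_def measure_return less_imp_le)
  qed
  then show ?thesis unfolding dominated_def using real_distr_return mgf_finite_return by blast
qed

text \<open>To the left of the threshold \<open>x0\<close> the tail of \<rho> is at least
  \<open>tail \<rho> x0\<close>, which is positive, while the other tail is at most 1.\<close>

lemma bounded_of_eventually:
  assumes "real_distr \<alpha>" "\<forall>\<^sub>F x in at_top. tail \<alpha> x \<le> K * tail \<rho> x"
  shows "\<exists>C. \<forall>x. tail \<alpha> x \<le> C * tail \<rho> x"
proof -
  obtain x0 where x0: "\<And>x. x0 \<le> x \<Longrightarrow> tail \<alpha> x \<le> K * tail \<rho> x"
    using assms(2) by (auto simp: eventually_at_top_linorder)
  have "tail \<alpha> x \<le> max K (1 / tail \<rho> x0) * tail \<rho> x" for x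
  proof (cases "x0 \<le> x")
    case True
    then show ?thesis
      using x0[OF True] mult_right_mono[OF max.cobounded1, of "tail \<rho> x" K "1 / tail \<rho> x0"] tail_nonneg[of \<rho> x] by linarith
  next
    case False
    then have "1 \<le> 1 / tail \<rho> x0 * tail \<rho> x"
      using tail_antimono[OF distr, of x x0] R_pos[of x0] by simp
    then show ?thesis
      using tail_le_1[OF assms(1), of x] mult_right_mono[OF max.cobounded2, of "tail \<rho> x" "1 / tail \<rho> x0" K] tail_nonneg[of \<rho> x] by linarith
  qed
  then show ?thesis by blast
qed

text \<open>Replacing the factors by \<rho> one after the other reduces this to the square of
  \<rho>, whose tail is of the order of that of \<rho> by convolution equivalence.\<close>

lemma dominated_convolution:
  assumes "dominated \<alpha>" "dominated \<beta>"
  shows "dominated (convolution \<alpha> \<beta>)"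
proof -
  note \<alpha> = dominatedD[OF assms(1)] and \<beta> = dominatedD[OF assms(2)]
  obtain C where C: "0 \<le> C" "\<And>x. tail \<alpha> x \<le> C * tail \<rho> x" using \<alpha>(3) by blast
  obtain C' where C': "0 \<le> C'" "\<And>x. tail \<beta> x \<le> C' * tail \<rho> x" using \<beta>(3) by blast
  have le: "tail (convolution \<alpha> \<beta>) x \<le> C * (C' * tail (convolution \<rho> \<rho>) x)" for x
  proof -
    have int: "integrable \<eta> (\<lambda>s. tail \<eta>' (x - s))" if "real_distr \<eta>" "real_distr \<eta>'" for \<eta> \<eta>'
      using integrable_tail_mult[OF that, of "\<lambda>s. x - s" UNIV] by simp
    have "tail (convolution \<alpha> \<beta>) x \<le> (\<integral>s. C * tail \<rho> (x - s) \<partial>\<beta>)"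
      unfolding tail_convolution(1)[OF \<alpha>(1) \<beta>(1)]
      by (intro integral_mono integrable_mult_right int \<alpha> \<beta> distr C)
    also have "\<dots> = C * tail (convolution \<beta> \<rho>) x"
      by (simp add: tail_convolution(1)[OF distr \<beta>(1)] convolution_real_distr_commute[OF \<beta>(1) distr])
    also have "tail (convolution \<beta> \<rho>) x \<le> (\<integral>s. C' * tail \<rho> (x - s) \<partial>\<rho>)"
      unfolding tail_convolution(1)[OF \<beta>(1) distr]
      by (intro integral_mono integrable_mult_right int \<alpha> \<beta> distr C')
    also have "\<dots> = C' * tail (convolution \<rho> \<rho>) x"
      by (simp add: tail_convolution(1)[OF distr distr])
    finally show ?thesis using C(1) by (simp add: mult_left_mono)
  qed
  \<comment> \<open>The limit is 1; the bound 2 is an arbitrary larger number and leads to the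
    factor \<open>4 * mgf \<rho> \<gamma>\<close>.\<close>
  have "\<forall>\<^sub>F x in at_top. tail (conv_pow \<rho> 2) x / (2 * mgf \<rho> \<gamma> * tail \<rho> x) < 2"
    using S by (intro order_tendstoD(2)[of _ 1]) (auto simp: class_S_def)
  then have "\<forall>\<^sub>F x in at_top. tail (convolution \<alpha> \<beta>) x \<le> (C * (C' * (4 * mgf \<rho> \<gamma>))) * tail \<rho> x"
  proof eventually_elim
    case (elim x)
    then have "tail (convolution \<rho> \<rho>) x \<le> 4 * mgf \<rho> \<gamma> * tail \<rho> x"
      using mgf_pos[OF distr mgf_finite_\<rho>] R_pos[of x] by (simp add: conv_pow_2 distr field_simps)
    from mult_left_mono[OF mult_left_mono[OF this C'(1)] C(1)] le[of x] show ?case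
      by (simp add: mult.assoc)
  qed
  from bounded_of_eventually[OF real_distr_convolution[OF \<alpha>(1) \<beta>(1)] this] show ?thesis
    using \<alpha> \<beta> by (simp add: dominated_def real_distr_convolution mgf_finite_convolution)
qed

lemma dominated_conv_pow: "dominated \<mu> \<Longrightarrow> dominated (conv_pow \<mu> n)"
  by (induction n) (auto simp: dominated_return dominated_convolution)

section \<open>The one-big-jump principle along sequences\<close>

lemma R_quotient_seq:
  assumes "filterlim X at_top sequentially"
  shows "(\<lambda>k. tail \<rho> (X k + a) / tail \<rho> (X k)) \<longlonglongrightarrow> exp (- \<gamma> * a)"
  using filterlim_compose[OF R_quotient assms] .

text \<open>Domination bounds the limit profile \<open>a\<close> by a multiple of
  \<open>exp (- \<gamma> * z)\<close>, which is integrable in \<open>s\<close> by the moment of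
  \<open>\<beta>\<close>. Below the truncation level the quotients are at most their value at
  \<open>s = A\<close>, a quantity bounded in \<open>k\<close>, and dominated convergence applies.
  Convergence is asked for only almost everywhere because limit profiles may fail on countable
  sets.\<close>

lemma truncated_tendsto:
  assumes X: "filterlim X at_top sequentially"
    and \<alpha>: "dominated \<alpha>" and \<beta>: "dominated \<beta>"
    and a[measurable]: "a \<in> borel_measurable borel"
    and lim: "AE s in \<beta>. (\<lambda>k. tail \<alpha> (X k + (y - s)) / tail \<rho> (X k)) \<longlonglongrightarrow> a (y - s)"
  shows "integrable \<beta> (\<lambda>s. a (y - s))"
    and "(\<lambda>k. (\<integral>s. indicator {..A} s * tail \<alpha> (X k + y - s) \<partial>\<beta>) / tail \<rho> (X k)) \<longlonglongrightarrow> (\<integral>s. indicator {..A} s * a (y - s) \<partial>\<beta>)"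
proof -
  note \<alpha>' = dominatedD[OF \<alpha>] and \<beta>' = dominatedD[OF \<beta>]
  interpret prob_space \<beta> using real_distrD[OF \<beta>'(1)] by simp
  note [measurable_cong] = real_distrD(4)[OF \<beta>'(1)] and [measurable] = borel_measurable_tail[OF \<alpha>'(1)]
  obtain C where C: "0 \<le> C" "\<And>x. tail \<alpha> x \<le> C * tail \<rho> x" using \<alpha>'(3) by blast
  have quot: "tail \<alpha> (X k + z) / tail \<rho> (X k) \<le> C * (tail \<rho> (X k + z) / tail \<rho> (X k))" for k z
    using C(2)[of "X k + z"] R_pos[of "X k"] by (simp add: divide_right_mono)
  have bnd: "AE s in \<beta>. 0 \<le> a (y - s) \<and> a (y - s) \<le> C * exp (- \<gamma> * (y - s))"
    using lim
  proof eventually_elim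
    case (elim s)
    have "a (y - s) \<le> C * exp (- \<gamma> * (y - s))"
      by (rule LIMSEQ_le[OF elim tendsto_mult_left[OF R_quotient_seq[OF X]]]) (use quot in auto)
    moreover have "0 \<le> a (y - s)"
      using R_pos by (intro LIMSEQ_le_const[OF elim]) (auto simp: tail_nonneg less_imp_le)
    ultimately show ?case by simp
  qed
  have "integrable \<beta> (\<lambda>s. C * exp (- \<gamma> * y) * exp (\<gamma> * s))"
    using \<beta>' by (intro integrable_mult_right) (simp add: mgf_finite_iff_integrable)
  then show "integrable \<beta> (\<lambda>s. a (y - s))"
  proof (rule Bochner_Integration.integrable_bound)
    show "AE s in \<beta>. norm (a (y - s)) \<le> norm (C * exp (- \<gamma> * y) * exp (\<gamma> * s))"
      using bnd by eventually_elim (use C in \<open>simp add: exp_add[symmetric] mult.assoc algebra_simps\<close>)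
  qed measurable
  have "Bseq (\<lambda>k. C * (tail \<rho> (X k + (y - A)) / tail \<rho> (X k)))"
    by (rule convergent_imp_Bseq, rule convergentI, rule tendsto_mult_left, rule R_quotient_seq[OF X])
  then obtain B where B: "\<And>k. \<bar>C * (tail \<rho> (X k + (y - A)) / tail \<rho> (X k))\<bar> \<le> B"
    by (auto simp: Bseq_def)
  have B0: "0 \<le> B" using B[of 0] by linarith
  have "(\<lambda>k. \<integral>s. indicator {..A} s * tail \<alpha> (X k + y - s) / tail \<rho> (X k) \<partial>\<beta>) \<longlonglongrightarrow> (\<integral>s. indicator {..A} s * a (y - s) \<partial>\<beta>)"
  proof (rule integral_dominated_convergence[where w="\<lambda>_. B"])
    show "AE s in \<beta>. (\<lambda>k. indicator {..A} s * tail \<alpha> (X k + y - s) / tail \<rho> (X k)) \<longlonglongrightarrow> indicator {..A} s * a (y - s)"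
      using lim
    proof eventually_elim
      case (elim s)
      from tendsto_mult_left[OF this, of "indicator {..A} s"] show ?case
        by (simp add: add_diff_eq)
    qed
    fix k
    have "norm (indicator {..A} s * tail \<alpha> (X k + y - s) / tail \<rho> (X k)) \<le> B" for s
    proof (cases "s \<le> A")
      case True
      then have "tail \<alpha> (X k + y - s) / tail \<rho> (X k) \<le> tail \<alpha> (X k + (y - A)) / tail \<rho> (X k)"
        using R_pos[of "X k"] by (intro divide_right_mono tail_antimono \<alpha>') auto
      also have "\<dots> \<le> B"
        using quot[of k "y - A"] B[of k] by linarith
      finally show ?thesis using True R_pos[of "X k"] by (simp add: tail_nonneg)
    qed (use B0 in simp)
    then show "AE s in \<beta>. norm (indicator {..A} s * tail \<alpha> (X k + y - s) / tail \<rho> (X k)) \<le> B" by simp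
  qed (simp_all, measurable)
  then show "(\<lambda>k. (\<integral>s. indicator {..A} s * tail \<alpha> (X k + y - s) \<partial>\<beta>) / tail \<rho> (X k)) \<longlonglongrightarrow> (\<integral>s. indicator {..A} s * a (y - s) \<partial>\<beta>)"
    by simp
qed

text \<open>Either summand may be the large one, and each possibility contributes the limit profile
  of that summand averaged over the other. The level \<open>A\<close> is taken so large that the
  joint part is negligible and the truncated limits are close to the full ones.\<close>

lemma tail_convolution_tendsto:
  assumes X: "filterlim X at_top sequentially"
    and \<alpha>: "dominated \<alpha>" and \<beta>: "dominated \<beta>"
    and a[measurable]: "a \<in> borel_measurable borel" and b[measurable]: "b \<in> borel_measurable borel"
    and lim_a: "AE s in \<beta>. (\<lambda>k. tail \<alpha> (X k + (y - s)) / tail \<rho> (X k)) \<longlonglongrightarrow> a (y - s)"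
    and lim_b: "AE u in \<alpha>. (\<lambda>k. tail \<beta> (X k + (y - u)) / tail \<rho> (X k)) \<longlonglongrightarrow> b (y - u)"
  shows "(\<lambda>k. tail (convolution \<alpha> \<beta>) (X k + y) / tail \<rho> (X k)) \<longlonglongrightarrow> (\<integral>s. a (y - s) \<partial>\<beta>) + (\<integral>u. b (y - u) \<partial>\<alpha>)"
proof (rule tendsto_of_approx)
  note \<alpha>' = dominatedD[OF \<alpha>] and \<beta>' = dominatedD[OF \<beta>]
  obtain C where C: "0 \<le> C" "\<And>x. tail \<alpha> x \<le> C * tail \<rho> x" using \<alpha>'(3) by blast
  obtain C' where C': "0 \<le> C'" "\<And>x. tail \<beta> x \<le> C' * tail \<rho> x" using \<beta>'(3) by blast
  note ta = truncated_tendsto[OF X \<alpha> \<beta> a lim_a] and tb = truncated_tendsto[OF X \<beta> \<alpha> b lim_b]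
  fix e :: real assume e: "0 < e"
  \<comment> \<open>\<open>exp (- \<gamma> * y) + 1\<close> eventually bounds the quotient of the
    tails of \<rho> at \<open>X k + y\<close> and \<open>X k\<close>, so that the joint part is at
    most \<open>e\<close>. The last summand keeps \<open>K\<close> positive if a domination constant
    is 0.\<close>
  define K where "K = C' * C * (exp (- \<gamma> * y) + 1) + 1"
  have K: "0 < K" using C C' by (auto simp: K_def intro!: add_nonneg_pos mult_nonneg_nonneg)
  obtain A0 where A0: "\<And>A. A0 \<le> A \<Longrightarrow> \<forall>\<^sub>F x in at_top. joint_tail \<rho> \<rho> A x \<le> e / K * tail \<rho> x"
    using joint_tail_small[of "e / K"] e K by auto
  let ?P = "\<lambda>A. \<integral>s. indicator {..A} s * a (y - s) \<partial>\<beta>" and ?Q = "\<lambda>A. \<integral>u. indicator {..A} u * b (y - u) \<partial>\<alpha>"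
  have "((\<lambda>A. ?P A + ?Q A) \<longlongrightarrow> (\<integral>s. a (y - s) \<partial>\<beta>) + (\<integral>u. b (y - u) \<partial>\<alpha>)) at_top"
    by (intro tendsto_add tendsto_truncated_integral \<alpha>' \<beta>' ta(1) tb(1))
  from tendstoD[OF this e] eventually_ge_at_top[of A0]
  have "\<forall>\<^sub>F A in at_top. A0 \<le> A \<and> dist (?P A + ?Q A) ((\<integral>s. a (y - s) \<partial>\<beta>) + (\<integral>u. b (y - u) \<partial>\<alpha>)) < e"
    by eventually_elim simp
  then obtain A where A: "A0 \<le> A" "dist (?P A + ?Q A) ((\<integral>s. a (y - s) \<partial>\<beta>) + (\<integral>u. b (y - u) \<partial>\<alpha>)) < e"
    by (auto dest: eventually_happens)
  let ?g = "\<lambda>k. (\<integral>s. indicator {..A} s * tail \<alpha> (X k + y - s) \<partial>\<beta>) / tail \<rho> (X k)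
     + (\<integral>u. indicator {..A} u * tail \<beta> (X k + y - u) \<partial>\<alpha>) / tail \<rho> (X k)"
  have Xy: "filterlim (\<lambda>k. X k + y) at_top sequentially"
    using filterlim_tendsto_add_at_top[OF tendsto_const X] by (simp add: add.commute)
  have "\<forall>\<^sub>F k in sequentially. tail \<rho> (X k + y) / tail \<rho> (X k) < exp (- \<gamma> * y) + 1"
    by (rule order_tendstoD(2)[OF R_quotient_seq[OF X]]) simp
  moreover have "\<forall>\<^sub>F k in sequentially. joint_tail \<rho> \<rho> A (X k + y) \<le> e / K * tail \<rho> (X k + y)"
    using A0[OF A(1)] Xy by (rule eventually_compose_filterlim)
  moreover have "\<forall>\<^sub>F k in sequentially. 2 * A \<le> X k + y"
    using Xy by (simp add: filterlim_at_top)
  ultimately have "\<forall>\<^sub>F k in sequentially. \<bar>tail (convolution \<alpha> \<beta>) (X k + y) / tail \<rho> (X k) - ?g k\<bar> \<le> e"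
  proof eventually_elim
    case (elim k)
    have "joint_tail \<alpha> \<beta> A (X k + y) \<le> C' * C * joint_tail \<rho> \<rho> A (X k + y)"
      by (rule joint_tail_le[OF \<alpha>'(1) \<beta>'(1) distr C(2) C'(2,1)])
    also have "\<dots> \<le> C' * C * (e / K * tail \<rho> (X k + y))"
      using C C' elim by (intro mult_left_mono) auto
    finally have "joint_tail \<alpha> \<beta> A (X k + y) / tail \<rho> (X k) \<le> C' * C * (e / K * tail \<rho> (X k + y)) / tail \<rho> (X k)"
      using R_pos[of "X k"] by (intro divide_right_mono) auto
    also have "\<dots> = C' * C * (e / K) * (tail \<rho> (X k + y) / tail \<rho> (X k))"
      by simp
    also have "\<dots> \<le> C' * C * (e / K) * (exp (- \<gamma> * y) + 1)"
      using elim C C' e K by (intro mult_left_mono) auto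
    also have "\<dots> = (C' * C * (exp (- \<gamma> * y) + 1)) / K * e"
      by simp
    also have "\<dots> \<le> 1 * e"
      using e K by (intro mult_right_mono) (auto simp: K_def)
    finally show ?case
      using R_pos[of "X k"] unfolding tail_convolution(2)[OF \<alpha>'(1) \<beta>'(1) elim(3)]
      by (simp add: add_divide_distrib joint_tail_nonneg)
  qed
  moreover have "?g \<longlonglongrightarrow> ?P A + ?Q A"
    by (intro tendsto_add ta(2) tb(2))
  moreover have "\<bar>?P A + ?Q A - ((\<integral>s. a (y - s) \<partial>\<beta>) + (\<integral>u. b (y - u) \<partial>\<alpha>))\<bar> \<le> e"
    using A(2) by (simp add: dist_real_def)
  ultimately show "\<exists>g l. g \<longlonglongrightarrow> l \<and> \<bar>l - ((\<integral>s. a (y - s) \<partial>\<beta>) + (\<integral>u. b (y - u) \<partial>\<alpha>))\<bar> \<le> e \<and>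
      (\<forall>\<^sub>F k in sequentially. \<bar>tail (convolution \<alpha> \<beta>) (X k + y) / tail \<rho> (X k) - g k\<bar> \<le> e)"
    by blast
qed

end

section \<open>Limits of tail quotients\<close>

text \<open>\<open>y - s\<close> meets \<open>N\<close> with positive probability only if
  \<open>y\<close> is the sum of a point of \<open>N\<close> and an atom of \<open>\<beta>\<close>,
  and there are only countably many atoms.\<close>

lemma AE_diff_notin_countable:
  assumes \<beta>: "real_distr \<beta>" and N: "countable N"
  shows "\<exists>N'. countable N' \<and> (\<forall>y. y \<notin> N' \<longrightarrow> (AE s in \<beta>. y - s \<notin> N))"
proof -
  interpret prob_space \<beta> using real_distrD[OF \<beta>] by simp
  have "countable {t. measure \<beta> {t} \<noteq> 0}" by (rule countable_support)
  with N have "countable ((\<lambda>(n, t). n + t) ` (N \<times> {t. measure \<beta> {t} \<noteq> 0}))" by auto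
  moreover have "AE s in \<beta>. y - s \<notin> N" if y: "y \<notin> (\<lambda>(n, t). n + t) ` (N \<times> {t. measure \<beta> {t} \<noteq> 0})" for y
  proof -
    have "{y - n} \<in> null_sets \<beta>" if "n \<in> N" for n
    proof -
      have "measure \<beta> {y - n} = 0"
      proof (rule ccontr)
        assume "measure \<beta> {y - n} \<noteq> 0"
        with that have "n + (y - n) \<in> (\<lambda>(n, t). n + t) ` (N \<times> {t. measure \<beta> {t} \<noteq> 0})" by blast
        with y show False by simp
      qed
      then show ?thesis
        by (intro null_setsI) (auto simp: emeasure_eq_measure real_distrD[OF \<beta>])
    qed
    with N have "(\<Union>n\<in>N. {y - n}) \<in> null_sets \<beta>" by (rule null_sets_UN')
    from AE_not_in[OF this] show ?thesis
      by eventually_elim force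
  qed
  ultimately show ?thesis by blast
qed

text \<open>Every right neighbourhood contains points outside a countable set, so relations proved
  off such a set extend to all points.\<close>

lemma le_of_continuous_at_right:
  fixes F G :: "real \<Rightarrow> real"
  assumes "continuous (at_right x) F" "continuous (at_right x) G"
    and N: "countable N" "\<And>y. y \<notin> N \<Longrightarrow> F y \<le> G y"
  shows "F x \<le> G x"
proof (rule ccontr)
  assume "\<not> F x \<le> G x"
  then have "0 < F x - G x" by simp
  moreover have "((\<lambda>y. F y - G y) \<longlongrightarrow> F x - G x) (at_right x)"
    using assms(1,2) by (intro tendsto_diff) (auto simp: continuous_within)
  ultimately have "\<forall>\<^sub>F y in at_right x. 0 < F y - G y"
    by (rule order_tendstoD(1)[rotated])
  then obtain b where b: "x < b" "\<And>y. x < y \<Longrightarrow> y < b \<Longrightarrow> 0 < F y - G y"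
    by (auto simp: eventually_at_right_field)
  have "\<not> {x<..<b} \<subseteq> N"
    using b(1) N(1) uncountable_open_interval countable_subset by blast
  then obtain y where "x < y" "y < b" "y \<notin> N"
    by (meson greaterThanLessThan_iff subsetI)
  with b(2)[of y] N(2)[of y] show False by simp
qed

context convolution_equivalent
begin

text \<open>Induction with one factor split off: the large summand is either the new factor or one
  of the \<open>Suc j\<close> old ones. The exceptional set changes in each step but stays
  countable. The induction starts at the point mass \<open>conv_pow \<mu> 0\<close>, against which
  the integral is \<open>m y\<close>.\<close>

lemma conv_pow_tendsto:
  assumes X: "filterlim X at_top sequentially" and \<mu>: "dominated \<mu>"
    and m[measurable]: "m \<in> borel_measurable borel"
    and m_bound: "\<And>y. 0 \<le> m y" "\<And>y. m y \<le> C * exp (- \<gamma> * y)"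
    and N: "countable N" "\<And>y. y \<notin> N \<Longrightarrow> (\<lambda>k. tail \<mu> (X k + y) / tail \<rho> (X k)) \<longlonglongrightarrow> m y"
  shows "\<exists>N'. countable N' \<and> (\<forall>y. y \<notin> N' \<longrightarrow> (\<lambda>k. tail (conv_pow \<mu> (Suc j)) (X k + y) / tail \<rho> (X k)) \<longlonglongrightarrow>
    real (Suc j) * (\<integral>u. m (y - u) \<partial>conv_pow \<mu> j))"
proof (induction j)
  case 0
  have "(\<lambda>k. tail (conv_pow \<mu> (Suc 0)) (X k + y) / tail \<rho> (X k)) \<longlonglongrightarrow> real (Suc 0) * (\<integral>u. m (y - u) \<partial>conv_pow \<mu> 0)" if "y \<notin> N" for y
  proof -
    have "(\<integral>u. m (y - u) \<partial>return borel 0) = m (y - 0)"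
      by (rule integral_return) auto
    then show ?thesis
      using N(2)[OF that] dominatedD(1)[OF \<mu>] by (simp add: convolution_return)
  qed
  with N(1) show ?case by blast
next
  case (Suc j)
  note \<mu>' = dominatedD[OF \<mu>]
  let ?b = "conv_pow \<mu>"
  have dom: "dominated (?b i)" for i by (rule dominated_conv_pow[OF \<mu>])
  note b' = dominatedD[OF dom]
  let ?h = "\<lambda>y. real (Suc j) * (\<integral>u. m (y - u) \<partial>?b j)"
  from Suc obtain M where M: "countable M" "\<And>y. y \<notin> M \<Longrightarrow> (\<lambda>k. tail (?b (Suc j)) (X k + y) / tail \<rho> (X k)) \<longlonglongrightarrow> ?h y"
    by blast
  obtain N1 where N1: "countable N1" "\<And>y. y \<notin> N1 \<Longrightarrow> AE s in ?b (Suc j). y - s \<notin> N"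
    using AE_diff_notin_countable[OF b'(1) N(1)] by blast
  obtain N2 where N2: "countable N2" "\<And>y. y \<notin> N2 \<Longrightarrow> AE u in \<mu>. y - u \<notin> M"
    using AE_diff_notin_countable[OF \<mu>'(1) M(1)] by blast
  have h: "?h \<in> borel_measurable borel"
  proof -
    interpret sigma_finite_measure "?b j" using real_distrD[OF b'(1)] by simp
    note [measurable_cong] = real_distrD(4)[OF b'(1), of j]
    show ?thesis by measurable
  qed
  have "(\<lambda>k. tail (?b (Suc (Suc j))) (X k + y) / tail \<rho> (X k)) \<longlonglongrightarrow> real (Suc (Suc j)) * (\<integral>u. m (y - u) \<partial>?b (Suc j))"
    if y: "y \<notin> N1 \<union> N2" for y
  proof -
    have "(\<lambda>k. tail (convolution \<mu> (?b (Suc j))) (X k + y) / tail \<rho> (X k)) \<longlonglongrightarrow> (\<integral>s. m (y - s) \<partial>?b (Suc j)) + (\<integral>u. ?h (y - u) \<partial>\<mu>)"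
    proof (rule tail_convolution_tendsto[OF X \<mu> dom m h])
      show "AE s in ?b (Suc j). (\<lambda>k. tail \<mu> (X k + (y - s)) / tail \<rho> (X k)) \<longlonglongrightarrow> m (y - s)"
        using N1(2)[of y] y by (auto elim!: eventually_mono intro!: N(2))
      show "AE u in \<mu>. (\<lambda>k. tail (?b (Suc j)) (X k + (y - u)) / tail \<rho> (X k)) \<longlonglongrightarrow> ?h (y - u)"
        using N2(2)[of y] y by (auto elim!: eventually_mono intro!: M(2) simp del: conv_pow.simps of_nat_Suc)
    qed
    \<comment> \<open>Fubini absorbs the split factor into the power, so both contributions become
      multiples of one integral.\<close>
    also have "(\<integral>u. ?h (y - u) \<partial>\<mu>) = real (Suc j) * (\<integral>w. m (y - w) \<partial>?b (Suc j))"
    proof -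
      have "integrable (?b (Suc j)) (\<lambda>w. C * exp (- \<gamma> * y) * exp (\<gamma> * w))"
        using b' by (intro integrable_mult_right) (simp add: mgf_finite_iff_integrable del: conv_pow.simps)
      then have "integrable (?b (Suc j)) (\<lambda>w. m (y - w))"
      proof (rule Bochner_Integration.integrable_bound)
        note [measurable_cong] = real_distrD(4)[OF b'(1), of "Suc j"]
        show "(\<lambda>w. m (y - w)) \<in> borel_measurable (?b (Suc j))" by measurable
        have "norm (m (y - w)) \<le> norm (C * exp (- \<gamma> * y) * exp (\<gamma> * w))" for w
        proof -
          have "exp (- \<gamma> * (y - w)) = exp (- \<gamma> * y) * exp (\<gamma> * w)"
            by (simp add: exp_add[symmetric] algebra_simps)
          then show ?thesis using m_bound[of "y - w"] by (simp add: mult.assoc)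
        qed
        then show "AE w in ?b (Suc j). norm (m (y - w)) \<le> norm (C * exp (- \<gamma> * y) * exp (\<gamma> * w))" by simp
      qed
      from integral_convolution[OF \<mu>'(1) b'(1) this[unfolded conv_pow.simps]] show ?thesis
        by (simp add: diff_diff_eq)
    qed
    finally show ?thesis by (simp add: distrib_right)
  qed
  moreover have "countable (N1 \<union> N2)" using N1(1) N2(1) by simp
  ultimately show ?case by blast
qed

text \<open>Helly's theorem needs a bounded family, whence the quotient of the tails is replaced by
  its image under \<^term>\<open>\<lambda>t::real. - (t / (1 + t))\<close>.\<close>
lemma subsequence_tail_quotient_limit:
  assumes \<mu>: "dominated \<mu>" and X: "filterlim X at_top sequentially"
  obtains s m N C where "strict_mono s" "countable N" "m \<in> borel_measurable borel"
    "\<And>y. 0 \<le> m y" "\<And>y. m y \<le> C * exp (- \<gamma> * y)"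
    "\<And>y. continuous (at_right y) m" "\<And>y. y \<notin> N \<Longrightarrow> isCont m y"
    "\<And>y. isCont m y \<Longrightarrow> (\<lambda>k. tail \<mu> (X (s k) + y) / tail \<rho> (X (s k))) \<longlonglongrightarrow> m y"
proof -
  note \<mu>' = dominatedD[OF \<mu>]
  obtain C where C: "0 \<le> C" "\<And>x. tail \<mu> x \<le> C * tail \<rho> x" using \<mu>'(3) by blast
  define t where "t = (\<lambda>k y. tail \<mu> (X k + y) / tail \<rho> (X k))"
  \<comment> \<open>The minus sign makes the decreasing quotients increasing in \<open>y\<close>,
    the monotonicity that Helly's theorem asks for.\<close>
  define f where "f = (\<lambda>k y. - (t k y / (1 + t k y)))"
  have t0: "0 \<le> t k y" for k y
    using R_pos by (simp add: t_def tail_nonneg less_imp_le)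
  have t_eq: "t k y = - f k y / (1 + f k y)" for k y
    using t0[of k y] by (simp add: f_def field_simps)
  have phi_mono: "a / (1 + a) \<le> b / (1 + b)" if "0 \<le> a" "a \<le> b" for a b :: real
    using that by (simp add: field_simps)
  obtain s F where s: "strict_mono s" and F: "\<And>x. continuous (at_right x) F" "mono F"
      "\<And>x. continuous (at x) F \<Longrightarrow> (\<lambda>n. f (s n) x) \<longlonglongrightarrow> F x"
  proof -
    have "continuous (at_right x) (f k)" for k x
    proof -
      have "((\<lambda>y. X k + y) \<longlongrightarrow> X k + x) (at_right x)" by (intro tendsto_intros)
      then have "filterlim (\<lambda>y. X k + y) (at_right (X k + x)) (at_right x)"
        by (auto simp: filterlim_at eventually_at_filter)
      from filterlim_compose[OF _ this, of "tail \<mu>"] continuous_at_right_tail[OF \<mu>'(1), of "X k + x"]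
      have "((\<lambda>y. tail \<mu> (X k + y)) \<longlongrightarrow> tail \<mu> (X k + x)) (at_right x)"
        by (simp add: continuous_within)
      then show ?thesis
        unfolding continuous_within f_def using t0[of k x] R_pos[of "X k"]
        by (auto simp: t_def intro!: tendsto_intros)
    qed
    moreover have "mono (f k)" for k
      unfolding f_def
      by (intro monoI le_imp_neg_le phi_mono t0)
         (auto simp: t_def R_pos less_imp_le intro!: divide_right_mono tail_antimono \<mu>')
    moreover have "\<bar>f k y\<bar> \<le> 1" for k y
      using t0[of k y] by (simp add: f_def)
    ultimately show ?thesis
      using Helly_selection[of f 1] that by blast
  qed
  define N where "N = {y. \<not> isCont F y}"
  have N: "countable N"
    unfolding N_def using mono_ctble_discont[OF F(2)] .
  have Xs: "filterlim (\<lambda>k. X (s k)) at_top sequentially"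
    by (rule filterlim_compose[OF X filterlim_subseq[OF s]])
  \<comment> \<open>Limits exist only at continuity points of \<open>F\<close>; the two bounds are
    extended to all points by right continuity afterwards.\<close>
  have Fle: "F y \<le> 0 \<and> - (C * exp (- \<gamma> * y) / (1 + C * exp (- \<gamma> * y))) \<le> F y" if "y \<notin> N" for y
  proof
    from that have lim: "(\<lambda>n. f (s n) y) \<longlonglongrightarrow> F y" using F(3) by (simp add: N_def)
    show "F y \<le> 0"
      by (rule LIMSEQ_le_const2[OF lim]) (use t0 in \<open>auto simp: f_def\<close>)
    let ?r = "\<lambda>k. C * (tail \<rho> (X (s k) + y) / tail \<rho> (X (s k)))"
    have r: "?r \<longlonglongrightarrow> C * exp (- \<gamma> * y)"
      by (intro tendsto_mult_left R_quotient_seq Xs)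
    have "(\<lambda>k. - (?r k / (1 + ?r k))) \<longlonglongrightarrow> - (C * exp (- \<gamma> * y) / (1 + C * exp (- \<gamma> * y)))"
      using C(1) by (intro tendsto_minus tendsto_divide tendsto_add tendsto_const r) (simp add: add_nonneg_eq_0_iff)
    moreover have "- (?r k / (1 + ?r k)) \<le> f (s k) y" for k
      unfolding f_def
      by (intro le_imp_neg_le phi_mono t0) (use C(2) R_pos in \<open>simp add: t_def divide_right_mono less_imp_le\<close>)
    ultimately show "- (C * exp (- \<gamma> * y) / (1 + C * exp (- \<gamma> * y))) \<le> F y"
      using lim by (blast intro: LIMSEQ_le)
  qed
  have cont_phi: "continuous (at_right y) (\<lambda>y. - (C * exp (- \<gamma> * y) / (1 + C * exp (- \<gamma> * y))))" for y
    using C(1) by (auto intro!: continuous_intros simp: add_nonneg_eq_0_iff)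
  have F_le0: "F y \<le> 0" for y
    by (rule le_of_continuous_at_right[OF F(1) _ N, of y "\<lambda>_. 0"]) (use Fle in auto)
  have F_ge: "- (C * exp (- \<gamma> * y) / (1 + C * exp (- \<gamma> * y))) \<le> F y" for y
    by (rule le_of_continuous_at_right[OF cont_phi F(1) N, of y]) (use Fle in auto)
  have E0: "0 \<le> C * exp (- \<gamma> * y)" for y
    using C(1) by simp
  \<comment> \<open>The value -1 is the image of infinity under the transformation, so this says
    that the limit of the quotients is finite.\<close>
  have F1: "0 < 1 + F y" for y
  proof -
    have "C * exp (- \<gamma> * y) / (1 + C * exp (- \<gamma> * y)) < 1"
      using E0[of y] by (simp add: divide_less_eq)
    then show ?thesis using F_ge[of y] by linarith
  qed
  define m where "m = (\<lambda>y. - F y / (1 + F y))"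
  have m0: "0 \<le> m y" for y
    unfolding m_def using F_le0[of y] F1[of y] by (simp add: divide_nonneg_pos divide_nonpos_pos)
  have F_eq: "F = (\<lambda>y. - (m y / (1 + m y)))"
  proof
    show "F y = - (m y / (1 + m y))" for y
      using F1[of y] by (simp add: m_def field_simps)
  qed
  show thesis
  proof (rule that[OF s N])
    have [measurable]: "F \<in> borel_measurable borel"
      by (rule borel_measurable_mono[OF F(2)])
    show "m \<in> borel_measurable borel"
      unfolding m_def by measurable
    show "0 \<le> m y" for y by (rule m0)
    show "m y \<le> C * exp (- \<gamma> * y)" for y
    proof -
      have "- F y * (1 + C * exp (- \<gamma> * y)) \<le> C * exp (- \<gamma> * y)"
        using F_ge[of y] E0[of y] by (simp add: field_simps)
      then have "- F y \<le> C * exp (- \<gamma> * y) * (1 + F y)"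
        by (simp add: algebra_simps)
      then show ?thesis
        unfolding m_def by (subst pos_divide_le_eq[OF F1])
    qed
    show "continuous (at_right y) m" for y
      unfolding m_def using F1[of y] F(1)[of y]
      by (auto simp: continuous_within intro!: tendsto_intros)
    show "isCont m y" if "y \<notin> N" for y
      unfolding m_def using F1[of y] that by (auto simp: N_def intro!: continuous_intros)
    show "(\<lambda>k. tail \<mu> (X (s k) + y) / tail \<rho> (X (s k))) \<longlonglongrightarrow> m y" if "isCont m y" for y
    proof -
      have "1 + m y \<noteq> 0"
        using m0[of y] by linarith
      with that have "isCont F y"
        by (subst F_eq) (auto intro!: continuous_intros)
      from F(3)[OF this] have "(\<lambda>k. - f (s k) y / (1 + f (s k) y)) \<longlonglongrightarrow> m y"
        unfolding m_def using F1[of y] by (intro tendsto_intros) auto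
      then show ?thesis unfolding t_eq[symmetric] t_def .
    qed
  qed
qed

end

section \<open>Comparison of a distribution with its convolution powers\<close>

lemma tail_convolution_ge:
  assumes \<alpha>: "real_distr \<alpha>" and \<beta>: "real_distr \<beta>"
  shows "tail \<alpha> 0 * tail \<beta> x \<le> tail (convolution \<alpha> \<beta>) x"
proof -
  have "tail \<alpha> 0 * tail \<beta> x = (\<integral>u. indicator {0<..} u * tail \<beta> x \<partial>\<alpha>)"
    using \<alpha> by (simp add: tail_def real_distrD)
  also have "\<dots> \<le> (\<integral>u. indicator UNIV u * tail \<beta> (x - u) \<partial>\<alpha>)"
  proof (intro integral_mono integrable_tail_mult \<alpha> \<beta>)
    show "indicator {0<..} u * tail \<beta> x \<le> indicator UNIV u * tail \<beta> (x - u)" for u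
      using tail_antimono[OF \<beta>, of "x - u" x] by (auto simp: indicator_def tail_nonneg)
  qed auto
  also have "\<dots> = tail (convolution \<alpha> \<beta>) x"
    using tail_convolution(1)[OF \<beta> \<alpha>] by (simp add: convolution_real_distr_commute[OF \<beta> \<alpha>])
  finally show ?thesis .
qed

lemma tail_conv_pow_eq_0:
  assumes \<mu>: "real_distr \<mu>" and "tail \<mu> 0 = 0"
  shows "tail (conv_pow \<mu> j) 0 = 0"
proof (induction j)
  case 0
  then show ?case by (simp add: tail_def measure_return)
next
  case (Suc j)
  note b = real_distr_conv_pow[OF \<mu>, of j]
  interpret prob_space "conv_pow \<mu> j" using real_distrD[OF b] by simp
  from Suc have "{0<..} \<in> null_sets (conv_pow \<mu> j)"
    by (auto simp: tail_def emeasure_eq_measure real_distrD[OF b])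
  from AE_not_in[OF this] have "AE s in conv_pow \<mu> j. tail \<mu> (0 - s) = 0"
  proof eventually_elim
    case (elim s)
    then have "tail \<mu> (0 - s) \<le> tail \<mu> 0" by (intro tail_antimono[OF \<mu>]) auto
    then show ?case using assms(2) tail_nonneg[of \<mu> "0 - s"] by simp
  qed
  then show ?case
    by (simp add: tail_convolution(1)[OF \<mu> b] integral_eq_zero_AE)
qed

lemma tail_le_tail_conv_pow:
  assumes \<mu>: "real_distr \<mu>" and pos: "0 < tail \<mu> 0"
  shows "tail \<mu> 0 ^ j * tail \<mu> x \<le> tail (conv_pow \<mu> (Suc j)) x"
proof (induction j)
  case 0
  then show ?case by (simp add: convolution_return[OF \<mu>])
next
  case (Suc j)
  have "tail \<mu> 0 ^ Suc j * tail \<mu> x \<le> tail \<mu> 0 * tail (conv_pow \<mu> (Suc j)) x"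
    using mult_left_mono[OF Suc, of "tail \<mu> 0"] pos by (simp add: mult.assoc)
  also have "\<dots> \<le> tail (conv_pow \<mu> (Suc (Suc j))) x"
    using tail_convolution_ge[OF \<mu> real_distr_conv_pow[OF \<mu>], of "Suc j" x] by simp
  finally show ?case .
qed

section \<open>From the power back to its root\<close>

context convolution_equivalent
begin

text \<open>If \<mu> had no mass on the positive half-line, neither would its powers, against the
  positivity of the tail of \<rho>. Otherwise all but one of the summands may be taken positive,
  which bounds the tail of the power from below.\<close>

lemma dominated_root:
  assumes \<mu>: "real_distr \<mu>" "mgf_finite \<mu> \<gamma>" and \<rho>: "\<rho> = conv_pow \<mu> (Suc j)"
  shows "dominated \<mu>"
proof -
  have pos: "0 < tail \<mu> 0"
  proof (rule ccontr)
    assume "\<not> 0 < tail \<mu> 0"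
    then have "tail \<mu> 0 = 0" using tail_nonneg[of \<mu> 0] by simp
    then have "tail \<rho> 0 = 0" unfolding \<rho> by (rule tail_conv_pow_eq_0[OF \<mu>(1)])
    then show False using R_pos[of 0] by simp
  qed
  have "tail \<mu> x \<le> inverse (tail \<mu> 0 ^ j) * tail \<rho> x" for x
    using tail_le_tail_conv_pow[OF \<mu>(1) pos, of j x] pos unfolding \<rho>[symmetric]
    by (simp add: field_simps)
  with \<mu> show ?thesis unfolding dominated_def by blast
qed

lemma tail_root_tendsto:
  assumes \<mu>: "real_distr \<mu>" "mgf_finite \<mu> \<gamma>" and \<rho>: "\<rho> = conv_pow \<mu> (Suc j)"
    and nz: "\<And>z. mgf_complex \<mu> \<gamma> z \<noteq> 0"
  shows "((\<lambda>x. tail \<mu> x / tail \<rho> x) \<longlongrightarrow> 1 / (real (Suc j) * mgf (conv_pow \<mu> j) \<gamma>)) at_top"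
proof (rule ccontr)
  define \<beta> where "\<beta> = conv_pow \<mu> j"
  \<comment> \<open>The factor for which \<open>c * exp (- \<gamma> * y)\<close> solves the equation
    \<open>conv_m\<close> below.\<close>
  define c where "c = 1 / (real (Suc j) * mgf \<beta> \<gamma>)"
  assume "\<not> ?thesis"
  then obtain e where e: "0 < e" "\<not> (\<forall>\<^sub>F x in at_top. dist (tail \<mu> x / tail \<rho> x) c < e)"
    unfolding tendsto_iff c_def \<beta>_def by blast
  then have "\<exists>x\<ge>real k. \<not> dist (tail \<mu> x / tail \<rho> x) c < e" for k
    unfolding eventually_at_top_linorder by blast
  \<comment> \<open>A sequence along which the quotient stays away from \<open>c\<close>. A limit
    profile along a subsequence will contradict this at \<open>y = 0\<close>.\<close>
  then obtain X where X: "\<And>k. real k \<le> X k" "\<And>k. \<not> dist (tail \<mu> (X k) / tail \<rho> (X k)) c < e"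
    by metis
  have X_top: "filterlim X at_top sequentially"
    by (rule filterlim_at_top_mono[OF filterlim_real_sequentially]) (use X in auto)
  have dom: "dominated \<mu>" by (rule dominated_root[OF \<mu> \<rho>])
  obtain s m N C where s: "strict_mono s" and N: "countable N" and m[measurable]: "m \<in> borel_measurable borel"
    and m0: "\<And>y. 0 \<le> m y" and mC: "\<And>y. m y \<le> C * exp (- \<gamma> * y)"
    and m_right: "\<And>y. continuous (at_right y) m" and m_cont: "\<And>y. y \<notin> N \<Longrightarrow> isCont m y"
    and lim: "\<And>y. isCont m y \<Longrightarrow> (\<lambda>k. tail \<mu> (X (s k) + y) / tail \<rho> (X (s k))) \<longlonglongrightarrow> m y"
    by (rule subsequence_tail_quotient_limit[OF dom X_top], rule that)
  have Xs: "filterlim (\<lambda>k. X (s k)) at_top sequentially"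
    by (rule filterlim_compose[OF X_top filterlim_subseq[OF s]])
  have \<beta>: "real_distr \<beta>" "mgf_finite \<beta> \<gamma>"
    using \<mu> by (auto simp: \<beta>_def real_distr_conv_pow mgf_finite_conv_pow)
  interpret \<beta>: prob_space \<beta> using real_distrD[OF \<beta>(1)] by simp
  note [measurable_cong] = real_distrD(4)[OF \<beta>(1)]
  have int_exp: "integrable \<beta> (\<lambda>u. exp (\<gamma> * u))"
    using \<beta> by (simp add: mgf_finite_iff_integrable)
  have mgf_pos: "0 < mgf \<beta> \<gamma>" by (rule mgf_pos[OF \<beta>])
  obtain N' where N': "countable N'" "\<And>y. y \<notin> N' \<Longrightarrow>
      (\<lambda>k. tail \<rho> (X (s k) + y) / tail \<rho> (X (s k))) \<longlonglongrightarrow> real (Suc j) * (\<integral>u. m (y - u) \<partial>\<beta>)"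
    using conv_pow_tendsto[OF Xs dom m m0 mC N, of j] lim m_cont unfolding \<rho>[symmetric] \<beta>_def[symmetric] by blast
  \<comment> \<open>One limit computed twice: by the one-big-jump principle for the power, and by
    the membership of \<rho> in L(\<gamma>).\<close>
  have conv_m: "real (Suc j) * (\<integral>u. m (y - u) \<partial>\<beta>) = exp (- \<gamma> * y)" if "y \<notin> N'" for y
    by (rule LIMSEQ_unique[OF N'(2)[OF that] R_quotient_seq[OF Xs]])

  \<comment> \<open>Exponential tilting: the unknown becomes the bounded function \<open>M\<close>,
    and \<open>\<beta>\<close> becomes the finite measure \<open>\<nu>\<close>, whose Fourier
    transform is \<open>mgf_complex \<beta> \<gamma>\<close>.\<close>
  define M where "M = (\<lambda>y. exp (\<gamma> * y) * m y)"
  have [measurable]: "M \<in> borel_measurable borel" unfolding M_def by measurable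
  have M: "0 \<le> M y" "M y \<le> C" for y
  proof -
    show "0 \<le> M y" using m0[of y] by (simp add: M_def)
    have "M y \<le> exp (\<gamma> * y) * (C * exp (- \<gamma> * y))"
      unfolding M_def using mC by (intro mult_left_mono) auto
    then show "M y \<le> C" by (simp add: exp_minus field_simps)
  qed
  define \<nu> where "\<nu> = density \<beta> (\<lambda>u. ennreal (exp (\<gamma> * u)))"
  have [measurable_cong]: "sets \<nu> = sets borel"
    by (simp add: \<nu>_def real_distrD[OF \<beta>(1)])
  have "finite_measure \<nu>"
  proof
    have "emeasure \<nu> (space \<nu>) = (\<integral>\<^sup>+u. ennreal (exp (\<gamma> * u)) \<partial>\<beta>)"
      unfolding \<nu>_def by (subst emeasure_density) (auto intro!: nn_integral_cong simp: indicator_def)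
    then show "emeasure \<nu> (space \<nu>) \<noteq> \<infinity>"
      using \<beta>(2) by (simp add: mgf_finite_def)
  qed
  have \<nu>_integral: "(\<integral>u. g u \<partial>\<nu>) = (\<integral>u. exp (\<gamma> * u) *\<^sub>R g u \<partial>\<beta>)"
    if [measurable]: "g \<in> borel_measurable borel" for g :: "real \<Rightarrow> complex"
    unfolding \<nu>_def by (rule integral_density) auto
  \<comment> \<open>The mass of \<open>\<nu>\<close> is \<open>mgf \<beta> \<gamma>\<close>, so
    subtracting \<open>c\<close> makes the tilted equation homogeneous.\<close>
  define D where "D = (\<lambda>y. complex_of_real (M y - c))"
  have D_zero: "D y = 0" if "isCont m y" for y
  proof (rule wiener_tauberian[OF \<open>finite_measure \<nu>\<close> \<open>sets \<nu> = sets borel\<close> _ _ _ N'(1), of D "max 0 C + \<bar>c\<bar>"])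
    show "(\<integral>u. cis (z * u) \<partial>\<nu>) \<noteq> 0" for z
    proof -
      have "(\<integral>u. cis (z * u) \<partial>\<nu>) = mgf_complex \<beta> \<gamma> z"
        by (subst \<nu>_integral) (auto simp: mgf_complex_eq scaleR_conv_of_real)
      then show ?thesis
        using nz[of z] by (simp add: \<beta>_def mgf_complex_conv_pow[OF \<mu>])
    qed
    show "D \<in> borel_measurable borel" unfolding D_def by measurable
    show "norm (D x) \<le> max 0 C + \<bar>c\<bar>" for x
      unfolding D_def norm_of_real using M[of x] by linarith
    show "isCont D y"
      unfolding D_def M_def using that by (intro continuous_intros)
    show "(\<integral>u. D (y - u) \<partial>\<nu>) = 0" if "y \<notin> N'" for y
    proof -
      have int_m: "integrable \<beta> (\<lambda>u. m (y - u))"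
      proof (rule Bochner_Integration.integrable_bound)
        show "integrable \<beta> (\<lambda>u. C * exp (- \<gamma> * y) * exp (\<gamma> * u))"
          using int_exp by simp
        have "norm (m (y - u)) \<le> norm (C * exp (- \<gamma> * y) * exp (\<gamma> * u))" for u
          using m0[of "y - u"] mC[of "y - u"] by (simp add: right_diff_distrib exp_diff exp_minus field_simps)
        then show "AE u in \<beta>. norm (m (y - u)) \<le> norm (C * exp (- \<gamma> * y) * exp (\<gamma> * u))" by simp
      qed measurable
      have "exp (\<gamma> * u) * (M (y - u) - c) = exp (\<gamma> * y) * m (y - u) - c * exp (\<gamma> * u)" for u
        by (simp add: M_def right_diff_distrib exp_diff)
      then have "(\<integral>u. exp (\<gamma> * u) * (M (y - u) - c) \<partial>\<beta>) = exp (\<gamma> * y) * (\<integral>u. m (y - u) \<partial>\<beta>) - c * mgf \<beta> \<gamma>"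
        using int_m int_exp by (simp add: mgf_def)
      also have "(\<integral>u. m (y - u) \<partial>\<beta>) = exp (- \<gamma> * y) / real (Suc j)"
        using conv_m[OF that] by (simp add: field_simps)
      also have "exp (\<gamma> * y) * (exp (- \<gamma> * y) / real (Suc j)) - c * mgf \<beta> \<gamma> = 0"
        using mgf_pos by (simp add: c_def exp_minus)
      finally have "(\<integral>u. complex_of_real (exp (\<gamma> * u) * (M (y - u) - c)) \<partial>\<beta>) = 0"
        by (subst integral_complex_of_real) simp
      then show ?thesis
        by (subst \<nu>_integral) (simp_all add: D_def scaleR_conv_of_real)
    qed
  qed
  have m_eq: "m y = c * exp (- \<gamma> * y)" if "y \<notin> N" for y
  proof -
    have "M y = c"
      using D_zero[OF m_cont[OF that]] by (simp add: D_def flip: of_real_diff)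
    then show ?thesis by (simp add: M_def exp_minus field_simps)
  qed
  have cont_exp: "continuous (at_right y) (\<lambda>y. c * exp (- \<gamma> * y))" for y
    by (intro continuous_intros)
  \<comment> \<open>The identity is wanted at the possible discontinuities too: it makes
    \<open>m\<close> continuous everywhere, hence at 0, where the quotients are then known to
    converge.\<close>
  have "m y = c * exp (- \<gamma> * y)" for y
  proof (rule antisym)
    show "m y \<le> c * exp (- \<gamma> * y)"
      by (rule le_of_continuous_at_right[OF m_right cont_exp N]) (simp add: m_eq)
    show "c * exp (- \<gamma> * y) \<le> m y"
      by (rule le_of_continuous_at_right[OF cont_exp m_right N]) (simp add: m_eq)
  qed
  then have m_exp: "m = (\<lambda>y. c * exp (- \<gamma> * y))" by (rule ext)
  have "isCont m 0"
    unfolding m_exp by (intro continuous_intros)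
  moreover have "m 0 = c"
    unfolding m_exp by simp
  ultimately have "(\<lambda>k. tail \<mu> (X (s k)) / tail \<rho> (X (s k))) \<longlonglongrightarrow> c"
    using lim[of 0] by simp
  from tendstoD[OF this e(1)] show False
    using X(2) by simp
qed

text \<open>All quotients are taken relative to the tail of \<rho>. Shifted tails of \<mu> have the
  limit profile \<open>c * exp (- \<gamma> * y)\<close>, which gives L(\<gamma>), and the
  one-big-jump principle with this profile for both factors gives the limit
  \<open>2 * mgf \<mu> \<gamma> * c\<close> for the square.\<close>

lemma class_S_of_tail_equivalent:
  assumes \<mu>: "dominated \<mu>" and c: "0 < c"
    and lim: "((\<lambda>x. tail \<mu> x / tail \<rho> x) \<longlongrightarrow> c) at_top"
  shows "class_S \<gamma> \<mu>"
proof -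
  note \<mu>' = dominatedD[OF \<mu>]
  have shift: "((\<lambda>x. tail \<mu> (x + a) / tail \<rho> x) \<longlongrightarrow> c * exp (- \<gamma> * a)) at_top" for a
  proof -
    have "filterlim (\<lambda>x::real. x + a) at_top at_top"
      using filterlim_tendsto_add_at_top[OF tendsto_const filterlim_ident, of a] by (simp add: add.commute)
    from filterlim_compose[OF lim this]
    have "((\<lambda>x. tail \<mu> (x + a) / tail \<rho> (x + a) * (tail \<rho> (x + a) / tail \<rho> x)) \<longlongrightarrow> c * exp (- \<gamma> * a)) at_top"
      by (intro tendsto_mult R_quotient)
    then show ?thesis using R_pos by (simp add: less_imp_neq[symmetric])
  qed
  have pos: "0 < tail \<mu> x" for x
  proof -
    have "\<forall>\<^sub>F y in at_top. 0 < tail \<mu> y / tail \<rho> y \<and> x \<le> y"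
      using order_tendstoD(1)[OF lim c] eventually_ge_at_top[of x] by eventually_elim simp
    then obtain y where "0 < tail \<mu> y / tail \<rho> y" "x \<le> y"
      by (auto dest: eventually_happens)
    then show ?thesis
      using tail_antimono[OF \<mu>'(1), of x y] R_pos[of y] by (simp add: zero_less_divide_iff)
  qed
  have L: "class_L \<gamma> \<mu>"
    unfolding class_L_def
  proof (intro conjI allI pos)
    fix a
    have "((\<lambda>x. tail \<mu> (x + a) / tail \<rho> x / (exp (- \<gamma> * a) * (tail \<mu> x / tail \<rho> x))) \<longlongrightarrow> c * exp (- \<gamma> * a) / (exp (- \<gamma> * a) * c)) at_top"
      by (intro tendsto_divide tendsto_mult tendsto_const shift lim) (use c in auto)
    then show "((\<lambda>x. tail \<mu> (x + a) / (exp (- \<gamma> * a) * tail \<mu> x)) \<longlongrightarrow> 1) at_top"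
      using c R_pos by (simp add: less_imp_neq[symmetric])
  qed
  have "((\<lambda>x. tail (convolution \<mu> \<mu>) x / tail \<rho> x) \<longlongrightarrow> 2 * mgf \<mu> \<gamma> * c) at_top"
  proof (rule tendsto_at_topI_sequentially)
    fix X :: "nat \<Rightarrow> real" assume X: "filterlim X at_top sequentially"
    have shift_seq: "(\<lambda>k. tail \<mu> (X k + (0 - s)) / tail \<rho> (X k)) \<longlonglongrightarrow> c * exp (- \<gamma> * (0 - s))" for s
      by (rule filterlim_compose[OF shift X])
    have "(\<lambda>k. tail (convolution \<mu> \<mu>) (X k + 0) / tail \<rho> (X k)) \<longlonglongrightarrow>
        (\<integral>s. c * exp (- \<gamma> * (0 - s)) \<partial>\<mu>) + (\<integral>u. c * exp (- \<gamma> * (0 - u)) \<partial>\<mu>)"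
      by (rule tail_convolution_tendsto[OF X \<mu> \<mu>]) (measurable, intro AE_I2 shift_seq)+
    then show "(\<lambda>k. tail (convolution \<mu> \<mu>) (X k) / tail \<rho> (X k)) \<longlonglongrightarrow> 2 * mgf \<mu> \<gamma> * c"
      by (simp add: mgf_def mult_ac)
  qed
  then have "((\<lambda>x. tail (convolution \<mu> \<mu>) x / tail \<rho> x / (2 * mgf \<mu> \<gamma> * (tail \<mu> x / tail \<rho> x))) \<longlongrightarrow> 2 * mgf \<mu> \<gamma> * c / (2 * mgf \<mu> \<gamma> * c)) at_top"
    using c mgf_pos[OF \<mu>'(1,2)] by (intro tendsto_divide tendsto_mult tendsto_const lim) auto
  then have "((\<lambda>x. tail (conv_pow \<mu> 2) x / (2 * mgf \<mu> \<gamma> * tail \<mu> x)) \<longlongrightarrow> 1) at_top"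
    using c mgf_pos[OF \<mu>'(1,2)] R_pos by (simp add: conv_pow_2[OF \<mu>'(1)] less_imp_neq[symmetric])
  with L \<mu>'(2) show ?thesis by (simp add: class_S_def)
qed

end

theorem theorem1p3:
  fixes \<mu> :: "real measure" and \<gamma> :: real and n :: nat
  assumes "real_distr \<mu>"
    and "\<gamma> > 0"
    and "mgf_finite \<mu> \<gamma>"
    and "\<forall>z::real. mgf_complex \<mu> \<gamma> z \<noteq> 0"
    and "class_S \<gamma> (conv_pow \<mu> n)"
  shows "class_S \<gamma> \<mu>"
proof (cases n)
  \<comment> \<open>The zeroth power is the point mass at 0, whose tail vanishes at 1, so that it is
    not in S(\<gamma>).\<close>
  case 0
  with assms(5) have "0 < tail (return borel 0) 1"
    by (simp add: class_S_def class_L_def)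
  then show ?thesis by (simp add: tail_def measure_return)
next
  case (Suc j)
  interpret convolution_equivalent "conv_pow \<mu> (Suc j)" \<gamma>
    by unfold_locales (rule real_distr_conv_pow[OF assms(1)], use assms(5) Suc in simp)
  have "0 < 1 / (real (Suc j) * mgf (conv_pow \<mu> j) \<gamma>)"
    using assms by (simp add: mgf_pos real_distr_conv_pow mgf_finite_conv_pow)
  moreover have "dominated \<mu>"
    by (rule dominated_root[OF assms(1,3) refl])
  ultimately show ?thesis
    using class_S_of_tail_equivalent tail_root_tendsto[OF assms(1,3) refl] assms(4) by blast
qed

end
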